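(* There exist constants $c_r$ ($r=1,2,3,\dots$), depending only on $r$ and satisfying $c_r=O(\sqrt{r}\,\ln r)$ as $r\to\infty$, such that for all integers $r\ge 1$, all integers $n\ge 1$ and all $f\in C$, $$E_{n-1}(f)\le c_r\,\gamma_r^*\,\omega_r\left(f,\frac{\pi}{n}\right).$$
   Context: $C$ is the space of continuous $2\pi$-periodic functions $f$ on $\mathbb{R}$ with the uniform norm $\|f\|$. $T_{n-1}$ is the space of trigonometric polynomials of degree $\le n-1$, and $E_{n-1}(f)=\inf_{\tau\in T_{n-1}}\|f-\tau\|$. The $r$-th modulus of smoothness is $\omega_r(f,\delta)=\sup_{0<h\le\delta}\|\Delta_h^r(f,\cdot)\|$, where $\Delta_h^r(f,x)=\sum_{i=0}^r(-1)^i\binom{r}{i}f(x+ih)$. Also $\gamma_r^*=\binom{r}{\lfloor r/2\rfloor}^{-1}$. *)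

theory Defs
  imports "HOL-Analysis.Analysis" "HOL-Library.Landau_Symbols"
begin

definition periodic_C :: "(real \<Rightarrow> real) set" where
  "periodic_C = {f. continuous_on UNIV f \<and> (\<forall>x. f (x + 2 * pi) = f x)}"

(* The suprema below are taken in the conditionally complete lattice of the reals and
   are meaningful only for bounded sets.  Every f in periodic_C is bounded, the finite
   differences of f are bounded by 2^r * sup_norm f uniformly in h, and periodic_C is
   closed under subtracting trigonometric polynomials. *)

definition sup_norm :: "(real \<Rightarrow> real) \<Rightarrow> real" where
  "sup_norm f = (SUP x. \<bar>f x\<bar>)"

definition trig_polys :: "nat \<Rightarrow> (real \<Rightarrow> real) set" where
  "trig_polys m = {\<tau>. \<exists>a0 a b. \<forall>x.
     \<tau> x = a0 + (\<Sum>k=1..m. a k * cos (real k * x) + b k * sin (real k * x))}"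

definition best_approx :: "nat \<Rightarrow> (real \<Rightarrow> real) \<Rightarrow> real" where
  "best_approx m f = (INF \<tau>\<in>trig_polys m. sup_norm (\<lambda>x. f x - \<tau> x))"

definition fin_diff :: "nat \<Rightarrow> real \<Rightarrow> (real \<Rightarrow> real) \<Rightarrow> real \<Rightarrow> real" where
  "fin_diff r h f x = (\<Sum>i=0..r. (-1) ^ i * real (r choose i) * f (x + real i * h))"

(* Used for delta > 0 only, so that the index set of the supremum is nonempty. *)
definition modulus_smoothness :: "nat \<Rightarrow> (real \<Rightarrow> real) \<Rightarrow> real \<Rightarrow> real" where
  "modulus_smoothness r f \<delta> = (SUP h\<in>{0<..\<delta>}. sup_norm (fin_diff r h f))"

definition gamma_star :: "nat \<Rightarrow> real" where
  "gamma_star r = inverse (real (r choose (r div 2)))"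

end

theory Submission
  imports Defs
begin

text \<open>
  The constants can be taken of order \<open>sqrt r\<close>, which is stronger than \<open>sqrt r * ln r\<close>.

  By density it suffices to treat trigonometric sums of arbitrary degree, as long as no constant
  depends on that degree; and it suffices to treat even orders \<open>r = 2 * k\<close>, since
  \<open>gamma_star (2 * k - 1) = 2 * gamma_star (2 * k)\<close>. On a trigonometric sum, translations, differences
  and their averages are multipliers: they act on the component of frequency \<open>j\<close> by a factor.
  The central difference with step \<open>s\<close> has the factor \<open>(2 - 2 * cos (j * s)) ^ k\<close> up to a sign that
  does not depend on \<open>j\<close>. Averages of differences over \<open>0 \<le> s \<le> h = pi / n\<close> are bounded by the modulus
  of smoothness \<open>\<Omega>\<close>, so the task is to recover the frequencies \<open>j \<ge> n\<close> of \<open>f\<close> from such averages by a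
  multiplier of small norm. What is left of \<open>f\<close> is then a polynomial of degree less than \<open>n\<close>. Let
  \<open>C = 2 * k choose k\<close>, the mean value of the factor and the inverse of \<open>gamma_star (2 * k)\<close>.

  For frequencies \<open>j \<ge> 3 * n\<close> the average with a hat-shaped weight, divided by \<open>C\<close>, differs from
  the identity by an operator of norm less than one, because the oscillating terms of the factor are
  averaged out at the rate \<open>1 / (j * h)\<^sup>2\<close>. Hence this part of \<open>f\<close> is at most a constant times
  \<open>\<Omega> / C\<close> (\<open>high_frequency_bound\<close>).

  For frequencies between \<open>n\<close> and \<open>6 * n\<close> the average with the uniform weight is inverted
  directly. Its multiplier is, up to a factor of order one, the primitive of a power of the sine at
  \<open>j * h / 2\<close>. Already at \<open>j = n\<close> it has half the mass of a full bump, which makes it at least of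
  order \<open>C\<close>, but its slope is as large as \<open>4 ^ k\<close>, so that the inverse has norm of order
  \<open>4 ^ k / C\<^sup>2\<close> (\<open>middle_frequency_bound\<close>). Since \<open>4 ^ k \<le> 2 * sqrt k * C\<close>, this part of \<open>f\<close> is
  at most a constant times \<open>sqrt k * \<Omega> / C\<close>.

  All norms are estimated by expanding a multiplier into Fejer means, which are contractions; the
  coefficients are second differences (\<open>multiplier_bound_second_difference\<close>).
\<close>

section \<open>Multipliers on trigonometric sums\<close>

text \<open>
  A real trigonometric sum is written with one complex coefficient per frequency, so that
  translation and convolution act on the coefficients by multiplication.
\<close>

definition trig_sum :: "nat \<Rightarrow> (nat \<Rightarrow> complex) \<Rightarrow> real \<Rightarrow> real" where
  "trig_sum N c x = (\<Sum>j\<le>N. Re (c j * cis (real j * x)))"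

text \<open>
  This says that \<open>K\<close> bounds the operator norm, for the uniform norm, of the multiplier \<open>\<phi>\<close>
  on sums of degree at most \<open>N\<close>. Capping the degree keeps every sum finite; the constants \<open>K\<close>
  obtained below never depend on \<open>N\<close>, which is what makes the passage to all continuous
  functions possible.
\<close>

definition multiplier_bound :: "nat \<Rightarrow> (nat \<Rightarrow> real) \<Rightarrow> real \<Rightarrow> bool" where
  "multiplier_bound N \<phi> K \<longleftrightarrow>
     (\<forall>c B. (\<forall>x. \<bar>trig_sum N c x\<bar> \<le> B) \<longrightarrow> (\<forall>x. \<bar>trig_sum N (\<lambda>j. \<phi> j *\<^sub>R c j) x\<bar> \<le> K * B))"

lemma multiplier_boundD:
  assumes "multiplier_bound N \<phi> K" "\<And>x. \<bar>trig_sum N c x\<bar> \<le> B"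
  shows "\<bar>trig_sum N (\<lambda>j. \<phi> j *\<^sub>R c j) x\<bar> \<le> K * B"
  using assms unfolding multiplier_bound_def by blast

lemma trig_sum_cong:
  assumes "\<And>j. j \<le> N \<Longrightarrow> c j = d j"
  shows "trig_sum N c x = trig_sum N d x"
  unfolding trig_sum_def using assms by (intro sum.cong) auto

lemma trig_sum_add: "trig_sum N (\<lambda>j. c j + d j) x = trig_sum N c x + trig_sum N d x"
  by (simp only: trig_sum_def distrib_right plus_complex.sel sum.distrib)

lemma trig_sum_scaleR: "trig_sum N (\<lambda>j. t *\<^sub>R c j) x = t * trig_sum N c x"
  by (simp add: trig_sum_def sum_distrib_left algebra_simps)

lemma multiplier_bound_cong:
  assumes "\<And>j. j \<le> N \<Longrightarrow> \<phi> j = \<mu> j" "multiplier_bound N \<phi> K"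
  shows "multiplier_bound N \<mu> K"
proof -
  have "trig_sum N (\<lambda>j. \<mu> j *\<^sub>R c j) x = trig_sum N (\<lambda>j. \<phi> j *\<^sub>R c j) x" for c x
    by (rule trig_sum_cong) (simp add: assms(1))
  then show ?thesis using assms(2) by (simp add: multiplier_bound_def)
qed

lemma multiplier_bound_mono:
  assumes "multiplier_bound N \<phi> K" "K \<le> K'"
  shows "multiplier_bound N \<phi> K'"
  unfolding multiplier_bound_def
proof (intro allI impI)
  fix c B x assume B: "\<forall>x. \<bar>trig_sum N c x\<bar> \<le> B"
  then have "0 \<le> B" using abs_ge_zero order_trans by blast
  then have "K * B \<le> K' * B" using assms(2) by (rule mult_right_mono[rotated])
  then show "\<bar>trig_sum N (\<lambda>j. \<phi> j *\<^sub>R c j) x\<bar> \<le> K' * B"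
    using multiplier_boundD[OF assms(1), of c B x] B by auto
qed

lemma multiplier_bound_add:
  assumes "multiplier_bound N \<phi> K" "multiplier_bound N \<mu> L"
  shows "multiplier_bound N (\<lambda>j. \<phi> j + \<mu> j) (K + L)"
  unfolding multiplier_bound_def
proof (intro allI impI)
  fix c B x assume B: "\<forall>x. \<bar>trig_sum N c x\<bar> \<le> B"
  show "\<bar>trig_sum N (\<lambda>j. (\<phi> j + \<mu> j) *\<^sub>R c j) x\<bar> \<le> (K + L) * B"
    using multiplier_boundD[OF assms(1), of c B x] multiplier_boundD[OF assms(2), of c B x] B
    by (simp add: scaleR_add_left trig_sum_add distrib_right)
qed

lemma multiplier_bound_cmult:
  assumes "multiplier_bound N \<phi> K"
  shows "multiplier_bound N (\<lambda>j. t * \<phi> j) (\<bar>t\<bar> * K)"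
  unfolding multiplier_bound_def
proof (intro allI impI)
  fix c B x assume B: "\<forall>x. \<bar>trig_sum N c x\<bar> \<le> B"
  have "\<bar>trig_sum N (\<lambda>j. (t * \<phi> j) *\<^sub>R c j) x\<bar> = \<bar>t\<bar> * \<bar>trig_sum N (\<lambda>j. \<phi> j *\<^sub>R c j) x\<bar>"
    using trig_sum_scaleR[of N t "\<lambda>j. \<phi> j *\<^sub>R c j" x] by (simp add: abs_mult)
  also have "\<dots> \<le> \<bar>t\<bar> * (K * B)"
    using multiplier_boundD[OF assms, of c B x] B by (intro mult_left_mono) auto
  finally show "\<bar>trig_sum N (\<lambda>j. (t * \<phi> j) *\<^sub>R c j) x\<bar> \<le> \<bar>t\<bar> * K * B" by simp
qed

lemma multiplier_bound_compose:
  assumes "multiplier_bound N \<phi> K" "multiplier_bound N \<mu> L"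
  shows "multiplier_bound N (\<lambda>j. \<phi> j * \<mu> j) (K * L)"
  unfolding multiplier_bound_def
proof (intro allI impI)
  fix c B x assume B: "\<forall>x. \<bar>trig_sum N c x\<bar> \<le> B"
  show "\<bar>trig_sum N (\<lambda>j. (\<phi> j * \<mu> j) *\<^sub>R c j) x\<bar> \<le> K * L * B"
    using multiplier_boundD[OF assms(1), of "\<lambda>j. \<mu> j *\<^sub>R c j" "L * B" x]
      multiplier_boundD[OF assms(2), of c B] B
    by (simp add: mult.assoc)
qed

lemma multiplier_bound_one: "multiplier_bound N (\<lambda>j. 1) 1"
  by (simp add: multiplier_bound_def)

lemma multiplier_bound_sum:
  assumes "finite I" "\<And>i. i \<in> I \<Longrightarrow> multiplier_bound N (\<phi> i) (K i)"
  shows "multiplier_bound N (\<lambda>j. \<Sum>i\<in>I. \<phi> i j) (\<Sum>i\<in>I. K i)"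
  using assms
proof (induction I rule: finite_induct)
  case empty
  then show ?case by (simp add: multiplier_bound_def trig_sum_def)
next
  case (insert a I)
  then show ?case using multiplier_bound_add[of N "\<phi> a" "K a"] by simp
qed

lemma trig_sum_shift: "trig_sum N c (x + s) = trig_sum N (\<lambda>j. cis (real j * s) * c j) x"
  by (simp add: trig_sum_def cis_mult[symmetric] distrib_left mult_ac)

text \<open>
  This multiplier is the mean of the translations by \<open>s\<close> and by \<open>- s\<close>.
\<close>

lemma multiplier_bound_cos: "multiplier_bound N (\<lambda>j. cos (real j * s)) 1"
  unfolding multiplier_bound_def
proof (intro allI impI)
  fix c B x assume B: "\<forall>x. \<bar>trig_sum N c x\<bar> \<le> B"
  have "trig_sum N (\<lambda>j. cos (real j * s) *\<^sub>R c j) x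
      = trig_sum N (\<lambda>j. (1/2) *\<^sub>R (cis (real j * s) * c j + cis (real j * (-s)) * c j)) x"
    by (rule trig_sum_cong) (simp add: complex_eq_iff field_simps)
  also have "\<dots> = (trig_sum N c (x + s) + trig_sum N c (x + (-s))) / 2"
    by (simp only: trig_sum_scaleR trig_sum_add trig_sum_shift)
  finally show "\<bar>trig_sum N (\<lambda>j. cos (real j * s) *\<^sub>R c j) x\<bar> \<le> 1 * B"
    using B[rule_format, of "x + s"] B[rule_format, of "x + - s"] by (simp add: abs_le_iff)
qed

text \<open>
  Discrete orthogonality: averaging over \<open>L\<close> equidistant points annihilates every frequency below
  \<open>L\<close> except zero. It replaces convolution integrals in the next lemma.
\<close>

lemma sum_cis_roots_of_unity:
  fixes p :: int
  assumes "\<bar>p\<bar> < int L"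
  shows "(\<Sum>q<L. cis (of_int p * (2 * pi * real q / real L))) = (if p = 0 then of_nat L else 0)"
proof (cases "p = 0")
  case False
  have L: "L > 0" using assms by auto
  define z where "z = cis (2 * pi * (of_int p / real L))"
  have "z \<noteq> 1"
  proof
    assume "z = 1"
    then have "cos (2 * pi * (of_int p / real L)) = 1" unfolding z_def
      by (metis Re_complex_of_real cis.simps(1) of_real_1)
    then obtain m :: int where "2 * pi * (of_int p / real L) = of_int m * 2 * pi"
      unfolding cos_one_2pi_int by auto
    then have "real_of_int p = of_int m * real L" using L by (simp add: field_simps)
    then have "p = m * int L" by (metis of_int_eq_iff of_int_mult of_int_of_nat_eq)
    moreover from this False have "\<bar>m\<bar> \<ge> 1" by auto
    ultimately have "\<bar>p\<bar> \<ge> int L"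
      using mult_right_mono[of 1 "\<bar>m\<bar>" "int L"] by (simp add: abs_mult)
    then show False using assms by linarith
  qed
  have "cis (of_int p * (2 * pi * real q / real L)) = z ^ q" for q
    unfolding z_def by (subst Complex.DeMoivre) (simp add: mult_ac)
  then have "(\<Sum>q<L. cis (of_int p * (2 * pi * real q / real L))) = (\<Sum>q<L. z ^ q)"
    by simp
  also have "\<dots> = (z ^ L - 1) / (z - 1)" using \<open>z \<noteq> 1\<close> by (rule geometric_sum)
  also have "z ^ L = cis (2 * pi * of_int p)" using L unfolding z_def by (subst Complex.DeMoivre) (simp add: mult_ac)
  also have "\<dots> = 1" by (rule cis_multiple_2pi) simp
  finally show ?thesis using False by simp
qed simp

text \<open>
  Fejer means are contractions because the Fejer kernel, a squared modulus of an exponential sum,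
  is nonnegative and has mean one. Since only finitely many frequencies occur, the convolution
  may be taken over \<open>L\<close> equidistant points, with \<open>L\<close> beyond every frequency of the product.
\<close>

lemma fejer_multiplier_bound:
  assumes "l \<ge> 1"
  shows "multiplier_bound N (\<lambda>j. real (l - j) / real l) 1"
  unfolding multiplier_bound_def
proof (intro allI impI)
  fix c B x assume B: "\<forall>x. \<bar>trig_sum N c x\<bar> \<le> B"
  define L where "L = N + l + 1"
  define y where "y q = 2 * pi * real q / real L" for q :: nat
  define F where "F t = (cmod (\<Sum>a<l. cis (real a * t)))\<^sup>2" for t
  have L: "real L > 0" by (simp add: L_def)
  have F_expand: "complex_of_real (F t) = (\<Sum>a<l. \<Sum>b<l. cis ((real a - real b) * t))" for t
  proof -
    have "complex_of_real (F t) = (\<Sum>a<l. cis (real a * t)) * cnj (\<Sum>a<l. cis (real a * t))"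
      unfolding F_def by (metis complex_norm_square)
    also have "\<dots> = (\<Sum>a<l. \<Sum>b<l. cis (real a * t) * cis (- (real b * t)))"
      by (simp add: sum_product cis_cnj)
    finally show ?thesis by (simp add: cis_mult left_diff_distrib)
  qed
  \<comment> \<open>A frequency \<open>j\<close> survives once for each pair \<open>(a, b)\<close> below \<open>l\<close> with \<open>b = a + j\<close>.\<close>
  have moment: "(\<Sum>q<L. complex_of_real (F (y q)) * cis (real j * y q)) = of_nat (L * (l - j))"
    if "j \<le> N" for j
  proof -
    have "(\<Sum>q<L. complex_of_real (F (y q)) * cis (real j * y q))
        = (\<Sum>q<L. \<Sum>a<l. \<Sum>b<l. cis (of_int (int a - int b + int j) * y q))"
      by (simp add: F_expand sum_distrib_right cis_mult distrib_right)
    also have "\<dots> = (\<Sum>a<l. \<Sum>q<L. \<Sum>b<l. cis (of_int (int a - int b + int j) * y q))"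
      by (rule sum.swap)
    also have "\<dots> = (\<Sum>a<l. \<Sum>b<l. \<Sum>q<L. cis (of_int (int a - int b + int j) * y q))"
      by (intro sum.cong refl sum.swap)
    also have "\<dots> = (\<Sum>a<l. \<Sum>b<l. if b = a + j then of_nat L else 0)"
      unfolding y_def
      by (intro sum.cong refl, subst sum_cis_roots_of_unity) (use that in \<open>auto simp: L_def\<close>)
    also have "\<dots> = (\<Sum>a<l. if a < l - j then of_nat L else 0)"
      by (intro sum.cong refl) (auto simp: less_diff_conv)
    also have "\<dots> = (\<Sum>a<l - j. of_nat L)"
      by (rule sum.mono_neutral_cong_right) auto
    finally show ?thesis by simp
  qed
  have average: "(\<Sum>q<L. F (y q) * trig_sum N d (x + y q))
      = real L * real l * trig_sum N (\<lambda>j. (real (l - j) / real l) *\<^sub>R d j) x" for d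
  proof -
    have "(\<Sum>q<L. F (y q) * trig_sum N d (x + y q))
        = (\<Sum>j\<le>N. \<Sum>q<L. Re (d j * cis (real j * x) * (complex_of_real (F (y q)) * cis (real j * y q))))"
      unfolding trig_sum_def
      by (subst sum.swap, intro sum.cong refl)
         (simp add: sum_distrib_left distrib_left flip: cis_mult, simp add: algebra_simps)
    also have "\<dots> = (\<Sum>j\<le>N. Re (d j * cis (real j * x) * of_nat (L * (l - j))))"
      by (intro sum.cong refl) (simp only: moment[symmetric] atMost_iff sum_distrib_left Re_sum)
    also have "\<dots> = real L * real l * trig_sum N (\<lambda>j. (real (l - j) / real l) *\<^sub>R d j) x"
      unfolding trig_sum_def sum_distrib_left using assms
      by (intro sum.cong refl) (simp add: field_simps)
    finally show ?thesis .
  qed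
  have total: "(\<Sum>q<L. F (y q)) = real L * real l"
  proof -
    have "complex_of_real (\<Sum>q<L. F (y q)) = of_nat (L * l)" using moment[of 0] by simp
    then show ?thesis by (metis of_nat_mult of_real_eq_iff of_real_of_nat_eq)
  qed
  have "real L * real l * \<bar>trig_sum N (\<lambda>j. (real (l - j) / real l) *\<^sub>R c j) x\<bar>
      = \<bar>\<Sum>q<L. F (y q) * trig_sum N c (x + y q)\<bar>"
    unfolding average by (simp add: abs_mult)
  also have "\<dots> \<le> (\<Sum>q<L. \<bar>F (y q) * trig_sum N c (x + y q)\<bar>)" by (rule sum_abs)
  also have "\<dots> \<le> (\<Sum>q<L. F (y q) * B)"
    using B by (intro sum_mono) (auto simp: abs_mult F_def intro!: mult_left_mono)
  also have "\<dots> = real L * real l * B" by (simp add: total flip: sum_distrib_right)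
  finally show "\<bar>trig_sum N (\<lambda>j. (real (l - j) / real l) *\<^sub>R c j) x\<bar> \<le> 1 * B"
    using L assms by simp
qed

text \<open>
  Summation by parts, twice: a sequence that is eventually constant is a combination of the
  truncated linear sequences that define Fejer means, weighted by its second differences.
\<close>

lemma second_difference_expansion:
  fixes \<phi> :: "nat \<Rightarrow> real"
  assumes "\<And>j. j \<ge> K \<Longrightarrow> \<phi> j = \<phi> K"
  shows "\<phi> j = \<phi> K + (\<Sum>l=1..K. real (l - j) * (\<phi> (l - 1) - 2 * \<phi> l + \<phi> (l + 1)))"
proof -
  define \<delta> where "\<delta> l = \<phi> (l - 1) - 2 * \<phi> l + \<phi> (l + 1)" for l
  have tail: "(\<Sum>l=Suc j..K. \<delta> l) = \<phi> j - \<phi> (Suc j)" if "j \<le> K" for j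
    using that
  proof (induction j rule: inc_induct)
    case base
    show ?case using assms[of "Suc K"] by simp
  next
    case (step j)
    have "(\<Sum>l=Suc j..K. \<delta> l) = \<delta> (Suc j) + (\<Sum>l=Suc (Suc j)..K. \<delta> l)"
      using step by (simp add: sum.atLeast_Suc_atMost)
    then show ?case using step by (simp add: \<delta>_def)
  qed
  have main: "\<phi> j = \<phi> K + (\<Sum>l=1..K. real (l - j) * \<delta> l)" if "j \<le> K" for j
    using that
  proof (induction j rule: inc_induct)
    case base
    show ?case by simp
  next
    case (step j)
    have "(\<Sum>l=1..K. real (l - j) * \<delta> l)
        = (\<Sum>l=1..K. real (l - Suc j) * \<delta> l + (if Suc j \<le> l then \<delta> l else 0))"
      by (intro sum.cong refl) (auto simp: algebra_simps of_nat_diff not_le less_Suc_eq_le)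
    also have "\<dots> = (\<Sum>l=1..K. real (l - Suc j) * \<delta> l) + (\<Sum>l=Suc j..K. \<delta> l)"
      by (simp add: sum.distrib, rule sum.mono_neutral_cong_right) auto
    finally show ?case using step tail[of j] by simp
  qed
  show ?thesis
  proof (cases "j \<le> K")
    case True
    then show ?thesis using main[of j] by (simp add: \<delta>_def)
  next
    case False
    then show ?thesis using assms[of j] by simp
  qed
qed

text \<open>
  This is the tool behind every norm estimate below: the expansion into Fejer means, each of
  norm one, turns a bound on the variation of the slope of \<open>\<phi>\<close> into a bound on the operator.
\<close>

lemma multiplier_bound_second_difference:
  assumes "\<And>j. j \<ge> K \<Longrightarrow> \<phi> j = \<phi> K"
  shows "multiplier_bound N \<phi>
    (\<bar>\<phi> K\<bar> + (\<Sum>l=1..K. real l * \<bar>\<phi> (l - 1) - 2 * \<phi> l + \<phi> (l + 1)\<bar>))"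
proof -
  define \<delta> where "\<delta> l = \<phi> (l - 1) - 2 * \<phi> l + \<phi> (l + 1)" for l
  have "multiplier_bound N (\<lambda>j. (real l * \<delta> l) * (real (l - j) / real l)) (real l * \<bar>\<delta> l\<bar>)"
    if "l \<in> {1..K}" for l
    using multiplier_bound_cmult[OF fejer_multiplier_bound[of l N], of "real l * \<delta> l"] that
    by (simp add: abs_mult)
  then have "multiplier_bound N (\<lambda>j. \<Sum>l=1..K. (real l * \<delta> l) * (real (l - j) / real l))
      (\<Sum>l=1..K. real l * \<bar>\<delta> l\<bar>)"
    by (intro multiplier_bound_sum) auto
  moreover have "multiplier_bound N (\<lambda>j. \<phi> K * 1) (\<bar>\<phi> K\<bar> * 1)"
    by (rule multiplier_bound_cmult[OF multiplier_bound_one])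
  ultimately have "multiplier_bound N
      (\<lambda>j. \<phi> K * 1 + (\<Sum>l=1..K. (real l * \<delta> l) * (real (l - j) / real l)))
      (\<bar>\<phi> K\<bar> * 1 + (\<Sum>l=1..K. real l * \<bar>\<delta> l\<bar>))"
    by (intro multiplier_bound_add)
  moreover have "\<phi> K * 1 + (\<Sum>l=1..K. (real l * \<delta> l) * (real (l - j) / real l)) = \<phi> j" for j
  proof -
    have "(\<Sum>l=1..K. (real l * \<delta> l) * (real (l - j) / real l)) = (\<Sum>l=1..K. real (l - j) * \<delta> l)"
      by (intro sum.cong) auto
    then show ?thesis using second_difference_expansion[of K \<phi> j, OF assms] by (simp add: \<delta>_def)
  qed
  ultimately show ?thesis by (simp add: \<delta>_def)
qed

text \<open>
  For a convex decreasing sequence all weights of the expansion into Fejer means are nonnegative,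
  so the norms add up to the value of the expansion at frequency zero.
\<close>

lemma multiplier_bound_convex:
  assumes convex: "\<And>l. 1 \<le> l \<Longrightarrow> 2 * \<phi> l \<le> \<phi> (l - 1) + \<phi> (l + 1)"
    and decreasing: "\<And>l. \<phi> (Suc l) \<le> \<phi> l" and nonneg: "\<And>l. 0 \<le> \<phi> l"
  shows "multiplier_bound N \<phi> (\<phi> 0)"
proof -
  \<comment> \<open>Freezing the sequence at \<open>N\<close> keeps it convex, because it decreases up to that point.\<close>
  define \<mu> where "\<mu> j = \<phi> (min j N)" for j
  define \<delta> where "\<delta> l = \<mu> (l - 1) - 2 * \<mu> l + \<mu> (l + 1)" for l
  have const: "\<mu> j = \<mu> N" if "j \<ge> N" for j using that by (simp add: \<mu>_def)
  have "\<delta> l \<ge> 0" if "l \<in> {1..N}" for l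
  proof (cases "l = N")
    case True
    then show ?thesis using decreasing[of "N - 1"] that by (simp add: \<delta>_def \<mu>_def min_def)
  next
    case False
    with that have "min (l - 1) N = l - 1" "min (l + 1) N = l + 1" "min l N = l" by auto
    then show ?thesis using convex[of l] that by (simp add: \<delta>_def \<mu>_def)
  qed
  then have "\<bar>\<mu> N\<bar> + (\<Sum>l=1..N. real l * \<bar>\<delta> l\<bar>) = \<mu> N + (\<Sum>l=1..N. real (l - 0) * \<delta> l)"
    using nonneg[of N] by (simp add: \<mu>_def)
  also have "\<dots> = \<mu> 0" unfolding \<delta>_def by (rule second_difference_expansion[of N \<mu> 0, OF const, symmetric])
  finally have "\<bar>\<mu> N\<bar> + (\<Sum>l=1..N. real l * \<bar>\<delta> l\<bar>) = \<phi> 0" by (simp add: \<mu>_def)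
  then have "multiplier_bound N \<mu> (\<phi> 0)"
    using multiplier_bound_second_difference[of N \<mu> N, OF const] unfolding \<delta>_def by simp
  then show ?thesis by (rule multiplier_bound_cong[rotated]) (simp add: \<mu>_def)
qed

section \<open>Averaged differences of even order\<close>

lemma fin_diff_Suc: "fin_diff (Suc r) h f x = fin_diff r h f x - fin_diff r h f (x + h)"
proof -
  define g where "g i = (-1) ^ i * real (r choose i) * f (x + real i * h)" for i
  have "fin_diff (Suc r) h f x
      = f x + (\<Sum>i=0..r. (-1) ^ Suc i * real (Suc r choose Suc i) * f (x + real (Suc i) * h))"
    unfolding fin_diff_def by (subst sum.atLeast0_atMost_Suc_shift) simp
  also have "\<dots> = (g 0 + (\<Sum>i=0..r. g (Suc i))) - fin_diff r h f (x + h)"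
  proof -
    have "(-1) ^ Suc i * real (Suc r choose Suc i) * f (x + real (Suc i) * h)
        = g (Suc i) - (-1) ^ i * real (r choose i) * f (x + h + real i * h)" for i
      by (simp add: g_def algebra_simps)
    then show ?thesis by (simp add: sum_subtractf fin_diff_def g_def)
  qed
  also have "g 0 + (\<Sum>i=0..r. g (Suc i)) = (\<Sum>i=0..Suc r. g i)"
    by (subst sum.atLeast0_atMost_Suc_shift) simp
  also have "\<dots> = fin_diff r h f x"
    by (simp add: g_def fin_diff_def)
  finally show ?thesis .
qed

lemma fin_diff_sum:
  "fin_diff r h (\<lambda>x. \<Sum>j\<in>J. f j x) x = (\<Sum>j\<in>J. fin_diff r h (f j) x)"
  unfolding fin_diff_def sum_distrib_left by (rule sum.swap)

lemma fin_diff_harmonic: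
  "fin_diff (2 * k) s (\<lambda>x. Re (c * cis (t * x))) x
     = (2 * cos (t * s) - 2) ^ k * Re (c * cis (t * (x + real k * s)))"
proof (induction k arbitrary: x)
  case 0
  show ?case by (simp add: fin_diff_def)
next
  case (Suc k)
  define z where "z = c * cis (t * (x + real k * s))"
  have shift: "Re (c * cis (t * (x + y + real k * s))) = Re (z * cis (t * y))" for y
    by (simp add: z_def mult.assoc cis_mult algebra_simps)
  have "fin_diff (2 * Suc k) s (\<lambda>x. Re (c * cis (t * x))) x
      = (2 * cos (t * s) - 2) ^ k * (Re z - 2 * Re (z * cis (t * s)) + Re (z * cis (t * (s + s))))"
  proof -
    have step: "fin_diff (2 * Suc k) s f x
        = fin_diff (2 * k) s f x - 2 * fin_diff (2 * k) s f (x + s) + fin_diff (2 * k) s f (x + (s + s))" for f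
      by (simp add: fin_diff_Suc add.assoc)
    show ?thesis unfolding step Suc.IH shift z_def[symmetric] by algebra
  qed
  also have "Re z - 2 * Re (z * cis (t * s)) + Re (z * cis (t * (s + s)))
      = (2 * cos (t * s) - 2) * Re (z * cis (t * s))"
  proof -
    have double: "Re z - 2 * Re (z * cis a) + Re (z * cis (2 * a)) = (2 * cos a - 2) * Re (z * cis a)" for a
      by (simp add: cos_double_cos sin_double) (simp add: algebra_simps power2_eq_square)
    have arg: "t * (s + s) = 2 * (t * s)" by simp
    show ?thesis unfolding arg by (rule double)
  qed
  also have "Re (z * cis (t * s)) = Re (c * cis (t * (x + real (Suc k) * s)))"
    using shift[of s] by (simp add: algebra_simps)
  finally show ?case by (simp add: mult_ac)
qed

text \<open>
  Recentred at its midpoint, a difference of even order is a multiplier. Its sign is that of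
  \<open>(-1) ^ k\<close> at every frequency, so averages over the step size cannot cancel.
\<close>

lemma fin_diff_trig_sum:
  "fin_diff (2 * k) s (trig_sum N c) (x - real k * s)
     = trig_sum N (\<lambda>j. (2 * cos (real j * s) - 2) ^ k *\<^sub>R c j) x"
proof -
  have "fin_diff (2 * k) s (\<lambda>x. \<Sum>j\<le>N. Re (c j * cis (real j * x))) (x - real k * s)
      = (\<Sum>j\<le>N. (2 * cos (real j * s) - 2) ^ k * Re (c j * cis (real j * x)))"
    unfolding fin_diff_sum fin_diff_harmonic by simp
  then show ?thesis unfolding trig_sum_def[abs_def] by simp
qed

text \<open>
  Indices of the nonconstant terms in the cosine expansion of \<open>(2 - 2 * cos y) ^ k\<close>; the index
  \<open>k\<close> left out carries the mean value, a central binomial coefficient.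
\<close>

definition off_center :: "nat \<Rightarrow> nat set" where "off_center k = {0..2 * k} - {k}"

definition cos_coeff :: "nat \<Rightarrow> nat \<Rightarrow> real" where
  "cos_coeff k i = (-1) ^ (i + k) * real (2 * k choose i)"

lemma finite_off_center [simp]: "finite (off_center k)"
  by (simp add: off_center_def)

lemma off_center_neq: "i \<in> off_center k \<Longrightarrow> real i - real k \<noteq> 0"
  by (auto simp: off_center_def)

lemma abs_cos_coeff_le: "\<bar>cos_coeff k i\<bar> \<le> real (2 * k choose k)"
  by (simp add: cos_coeff_def abs_mult binomial_maximum')

text \<open>
  Both sides are the central difference of order \<open>2 * k\<close> of the cosine at zero, up to the sign
  \<open>(-1) ^ k\<close>: once evaluated as a multiplier and once by the definition.
\<close>

lemma cos_expansion:
  "(2 - 2 * cos y) ^ k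
     = real (2 * k choose k) + (\<Sum>i\<in>off_center k. cos_coeff k i * cos ((real i - real k) * y))"
proof -
  have "(2 * cos y - 2) ^ k = fin_diff (2 * k) y (\<lambda>x. Re (1 * cis (1 * x))) (- (real k * y))"
    unfolding fin_diff_harmonic by simp
  also have "\<dots> = (\<Sum>i=0..2*k. (-1) ^ i * real (2 * k choose i) * cos ((real i - real k) * y))"
    unfolding fin_diff_def by (simp add: algebra_simps)
  finally have "(-1) ^ k * (2 * cos y - 2) ^ k
      = (\<Sum>i=0..2*k. cos_coeff k i * cos ((real i - real k) * y))"
    by (simp add: sum_distrib_left cos_coeff_def power_add mult_ac)
  also have "\<dots> = cos_coeff k k * cos ((real k - real k) * y)
      + (\<Sum>i\<in>off_center k. cos_coeff k i * cos ((real i - real k) * y))"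
    unfolding off_center_def by (rule sum.remove) auto
  also have "cos_coeff k k * cos ((real k - real k) * y) = real (2 * k choose k)"
    by (simp add: cos_coeff_def flip: mult_2)
  also have "(-1) ^ k * (2 * cos y - 2) ^ k = (2 - 2 * cos y) ^ k"
    by (simp flip: power_mult_distrib)
  finally show ?thesis .
qed

text \<open>
  An average of differences over the step size is no larger than the differences themselves, and
  it is again a multiplier, the average \<open>W\<close> of the multipliers. The choice of the weight \<open>w\<close> is
  free; the proof uses two different weights for two ranges of frequencies.
\<close>

lemma averaged_difference_bound:
  assumes "h > 0" "k \<ge> 1" "0 \<le> \<Omega>"
    and w: "(w has_integral 1) {0..h}" "\<And>s. s \<in> {0..h} \<Longrightarrow> 0 \<le> w s"
    and W: "\<And>j. j \<le> N \<Longrightarrow> ((\<lambda>s. w s * (2 - 2 * cos (real j * s)) ^ k) has_integral W j) {0..h}"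
    and \<Omega>: "\<And>s x. s \<in> {0<..h} \<Longrightarrow> \<bar>fin_diff (2 * k) s (trig_sum N c) x\<bar> \<le> \<Omega>"
  shows "\<bar>trig_sum N (\<lambda>j. W j *\<^sub>R c j) x\<bar> \<le> \<Omega>"
proof -
  define g where "g s = w s * trig_sum N (\<lambda>j. (2 - 2 * cos (real j * s)) ^ k *\<^sub>R c j) x" for s
  have "((\<lambda>s. \<Sum>j\<le>N. (w s * (2 - 2 * cos (real j * s)) ^ k) * Re (c j * cis (real j * x)))
      has_integral (\<Sum>j\<le>N. W j * Re (c j * cis (real j * x)))) {0..h}"
    by (intro has_integral_sum has_integral_mult_left) (auto intro: W)
  moreover have "(\<Sum>j\<le>N. (w s * (2 - 2 * cos (real j * s)) ^ k) * Re (c j * cis (real j * x))) = g s" for s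
    unfolding g_def trig_sum_def sum_distrib_left by (intro sum.cong refl) (simp add: algebra_simps)
  moreover have "(\<Sum>j\<le>N. W j * Re (c j * cis (real j * x))) = trig_sum N (\<lambda>j. W j *\<^sub>R c j) x"
    unfolding trig_sum_def by (intro sum.cong refl) (simp add: algebra_simps)
  ultimately have g: "(g has_integral trig_sum N (\<lambda>j. W j *\<^sub>R c j) x) {0..h}" by simp
  have bound: "\<bar>g s\<bar> \<le> w s * \<Omega>" if s: "s \<in> {0..h}" for s
  proof -
    have "trig_sum N (\<lambda>j. (2 - 2 * cos (real j * s)) ^ k *\<^sub>R c j) x
        = (-1) ^ k * trig_sum N (\<lambda>j. (2 * cos (real j * s) - 2) ^ k *\<^sub>R c j) x"
      unfolding trig_sum_scaleR[symmetric] scaleR_scaleR power_mult_distrib[symmetric] by simp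
    then have "\<bar>trig_sum N (\<lambda>j. (2 - 2 * cos (real j * s)) ^ k *\<^sub>R c j) x\<bar>
        = \<bar>trig_sum N (\<lambda>j. (2 * cos (real j * s) - 2) ^ k *\<^sub>R c j) x\<bar>"
      by (simp add: abs_mult)
    also have "\<dots> \<le> \<Omega>"
    \<comment> \<open>The step size zero is not covered by the hypothesis, but there the multiplier vanishes.\<close>
    proof (cases "s = 0")
      case True
      then show ?thesis using assms(2,3) by (simp add: trig_sum_def power_0_left)
    next
      case False
      then show ?thesis using \<Omega>[of s "x - real k * s"] s by (simp add: fin_diff_trig_sum)
    qed
    finally show ?thesis using w(2)[OF s] by (simp add: g_def abs_mult mult_left_mono)
  qed
  have up: "((\<lambda>s. w s * \<Omega>) has_integral 1 * \<Omega>) {0..h}" by (intro has_integral_mult_left w)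
  have "trig_sum N (\<lambda>j. W j *\<^sub>R c j) x \<le> 1 * \<Omega>"
    by (rule has_integral_le[OF g up]) (use bound in \<open>auto simp: abs_le_iff\<close>)
  moreover have "- (1 * \<Omega>) \<le> trig_sum N (\<lambda>j. W j *\<^sub>R c j) x"
    by (rule has_integral_le[OF has_integral_neg[OF up] g]) (use bound in \<open>force simp: abs_le_iff\<close>)
  ultimately show ?thesis by simp
qed

text \<open>
  The hat has total mass one on \<open>{0..h}\<close>. Its cosine transform decays quadratically and, up to
  the factor \<open>1 / y\<^sup>2\<close>, is a difference of two bounded multipliers; both facts matter for high
  frequencies.
\<close>

definition hat :: "real \<Rightarrow> real \<Rightarrow> real" where "hat h s = 2 / h\<^sup>2 * (h - s)"

lemma hat_has_integral:
  assumes "h > 0"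
  shows "(hat h has_integral 1) {0..h}"
proof -
  define F where "F s = 2 / h\<^sup>2 * (h * s - s\<^sup>2 / 2)" for s
  have "(F has_real_derivative hat h s) (at s within {0..h})" for s
    unfolding F_def hat_def using assms
    by (auto intro!: derivative_eq_intros simp: field_simps)
  then have "(hat h has_integral F h - F 0) {0..h}"
    using assms by (intro fundamental_theorem_of_calculus)
      (auto simp flip: has_real_derivative_iff_has_vector_derivative)
  then show ?thesis using assms by (simp add: F_def power2_eq_square)
qed

lemma hat_cos_has_integral:
  assumes "h > 0" "y \<noteq> 0"
  shows "((\<lambda>s. hat h s * cos (y * s)) has_integral 2 * (1 - cos (y * h)) / (y * h)\<^sup>2) {0..h}"
proof -
  define F where "F s = 2 / h\<^sup>2 * ((h - s) * (sin (y * s) / y) - cos (y * s) / y\<^sup>2)" for s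
  have "(F has_real_derivative hat h s * cos (y * s)) (at s within {0..h})" for s
    unfolding F_def hat_def using assms
    by (auto intro!: derivative_eq_intros simp: field_simps power2_eq_square)
  then have "((\<lambda>s. hat h s * cos (y * s)) has_integral F h - F 0) {0..h}"
    using assms by (intro fundamental_theorem_of_calculus)
      (auto simp flip: has_real_derivative_iff_has_vector_derivative)
  moreover have "F h - F 0 = 2 * (1 - cos (y * h)) / (y * h)\<^sup>2"
    using assms by (simp add: F_def field_simps)
  ultimately show ?thesis by simp
qed

lemma hat_power_has_integral:
  assumes "h > 0" "j > 0"
  shows "((\<lambda>s. hat h s * (2 - 2 * cos (real j * s)) ^ k) has_integral
      real (2 * k choose k) + (\<Sum>i\<in>off_center k. cos_coeff k i *
        (2 * (1 - cos (real j * ((real i - real k) * h))) / (real j * ((real i - real k) * h))\<^sup>2))) {0..h}"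
proof -
  have "((\<lambda>s. hat h s * real (2 * k choose k) + (\<Sum>i\<in>off_center k. cos_coeff k i *
        (hat h s * cos (((real i - real k) * real j) * s)))) has_integral
      1 * real (2 * k choose k) + (\<Sum>i\<in>off_center k. cos_coeff k i *
        (2 * (1 - cos (((real i - real k) * real j) * h)) / (((real i - real k) * real j) * h)\<^sup>2))) {0..h}"
    using assms
    by (intro has_integral_add has_integral_sum has_integral_mult_right has_integral_mult_left
        hat_has_integral hat_cos_has_integral) (auto dest: off_center_neq)
  then show ?thesis
    by (simp add: cos_expansion distrib_left sum_distrib_left mult_ac)
qed

section \<open>High frequencies\<close>

text \<open>
  Only the values \<open>1 / j\<^sup>2\<close> for \<open>j \<ge> m\<close> matter. Below \<open>m\<close> the sequence follows the tangent at \<open>m\<close>,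
  which makes it convex and hence a multiplier of norm \<open>3 / m\<^sup>2\<close>, its value at zero.
\<close>

definition tangent_inverse_square :: "nat \<Rightarrow> nat \<Rightarrow> real" where
  "tangent_inverse_square m j =
     (if j < m then (3 * real m - 2 * real j) / real m ^ 3 else 1 / (real j)\<^sup>2)"

text \<open>
  The convex function \<open>1 / y\<^sup>2\<close> lies above its tangent at \<open>x\<close>.
\<close>

lemma inverse_square_ge_tangent:
  fixes x y :: real
  assumes "x > 0" "y > 0"
  shows "(3 * x - 2 * y) / x ^ 3 \<le> 1 / y\<^sup>2"
proof -
  have "0 \<le> (x - y)\<^sup>2 * (x + 2 * y)" using assms by simp
  also have "\<dots> = x ^ 3 - (3 * x - 2 * y) * y\<^sup>2" by (simp add: power2_eq_square power3_eq_cube algebra_simps)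
  finally show ?thesis using assms by (simp add: field_simps)
qed

lemma multiplier_bound_tangent_inverse_square:
  assumes "m \<ge> 1"
  shows "multiplier_bound N (tangent_inverse_square m) (3 / (real m)\<^sup>2)"
proof -
  let ?t = "tangent_inverse_square m"
  let ?lin = "\<lambda>y. (3 * real m - 2 * y) / real m ^ 3"
  have lin_le: "?lin (real j) \<le> ?t j" for j
    using inverse_square_ge_tangent[of "real m" "real j"] assms by (auto simp: tangent_inverse_square_def)
  have lin_eq: "?t j = ?lin (real j)" if "j \<le> m" for j
    using that assms by (cases "j = m") (auto simp: tangent_inverse_square_def field_simps power2_eq_square power3_eq_cube)
  have "2 * ?t l \<le> ?t (l - 1) + ?t (l + 1)" if l: "1 \<le> l" for l
  proof (cases "l \<le> m")
    case True
    have "2 * ?t l = ?lin (real (l - 1)) + ?lin (real (l + 1))"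
      unfolding lin_eq[OF True] using l by (simp add: of_nat_diff add_divide_distrib[symmetric])
    then show ?thesis using lin_le[of "l - 1"] lin_le[of "l + 1"] by linarith
  next
    case False
    define y where "y = real l"
    have y: "y > 1" using False assms by (simp add: y_def)
    have "2 / y\<^sup>2 \<le> 1 / (y - 1)\<^sup>2 + 1 / (y + 1)\<^sup>2"
    proof -
      have "y\<^sup>2 > 1" using y by simp
      then have "(y\<^sup>2 - 1)\<^sup>2 \<le> (y\<^sup>2 + 1) * y\<^sup>2" by (simp add: power2_eq_square algebra_simps)
      then have "2 * (y\<^sup>2 - 1)\<^sup>2 / (y\<^sup>2 * (y\<^sup>2 - 1)\<^sup>2) \<le> 2 * ((y\<^sup>2 + 1) * y\<^sup>2) / (y\<^sup>2 * (y\<^sup>2 - 1)\<^sup>2)"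
        by (intro divide_right_mono) auto
      then have "2 / y\<^sup>2 \<le> 2 * (y\<^sup>2 + 1) / (y\<^sup>2 - 1)\<^sup>2"
        using y \<open>y\<^sup>2 > 1\<close> by simp
      also have "(y\<^sup>2 - 1)\<^sup>2 = (y - 1)\<^sup>2 * (y + 1)\<^sup>2"
        by (simp add: power2_eq_square algebra_simps)
      also have "2 * (y\<^sup>2 + 1) / ((y - 1)\<^sup>2 * (y + 1)\<^sup>2) = 1 / (y - 1)\<^sup>2 + 1 / (y + 1)\<^sup>2"
        using y by (simp add: add_frac_eq) (simp add: power2_eq_square algebra_simps)
      finally show ?thesis .
    qed
    moreover have "\<not> l - 1 < m" "\<not> l + 1 < m" using False l by auto
    ultimately show ?thesis using False l by (simp add: tangent_inverse_square_def y_def of_nat_diff add_ac)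
  qed
  moreover have "?t (Suc l) \<le> ?t l" for l
  proof (cases "l < m")
    case True
    then show ?thesis using lin_eq[of "Suc l"] lin_eq[of l] by (simp add: divide_right_mono)
  next
    case False
    then show ?thesis using assms by (simp add: tangent_inverse_square_def frac_le power_mono)
  qed
  moreover have "0 \<le> ?t l" for l by (simp add: tangent_inverse_square_def)
  ultimately have "multiplier_bound N ?t (?t 0)" by (rule multiplier_bound_convex)
  moreover have "?t 0 = 3 / (real m)\<^sup>2"
    using assms by (simp add: tangent_inverse_square_def power2_eq_square power3_eq_cube)
  ultimately show ?thesis by simp
qed

lemma sum_inverse_squares_le: "(\<Sum>i=1..k. 1 / (real i)\<^sup>2) \<le> 2"
proof -
  have "(\<Sum>i=1..k. 1 / (real i)\<^sup>2) \<le> 2 - 1 / real k" if "k \<ge> 1"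
    using that
  proof (induction k rule: dec_induct)
    case (step k)
    have "1 / (real (Suc k))\<^sup>2 \<le> 1 / (real k * real (Suc k))"
      using step by (intro divide_left_mono) (auto simp: power2_eq_square)
    also have "\<dots> = 1 / real k - 1 / real (Suc k)" using step by (simp add: field_simps)
    finally show ?case using step by simp
  qed simp
  then show ?thesis by (cases k) (auto intro: order_trans)
qed

lemma sum_off_center_inverse_squares_le: "(\<Sum>i\<in>off_center k. 1 / (real i - real k)\<^sup>2) \<le> 4"
proof -
  have split: "off_center k = (\<lambda>i. k - i) ` {1..k} \<union> (\<lambda>i. k + i) ` {1..k}"
  proof (intro equalityI subsetI)
    fix i assume i: "i \<in> off_center k"
    show "i \<in> (\<lambda>i. k - i) ` {1..k} \<union> (\<lambda>i. k + i) ` {1..k}"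
    proof (cases "i < k")
      case True
      then show ?thesis by (intro UnI1 image_eqI[of _ _ "k - i"]) auto
    next
      case False
      then show ?thesis using i by (intro UnI2 image_eqI[of _ _ "i - k"]) (auto simp: off_center_def)
    qed
  qed (auto simp: off_center_def)
  have "(\<Sum>i\<in>off_center k. 1 / (real i - real k)\<^sup>2)
      = (\<Sum>i\<in>(\<lambda>i. k - i) ` {1..k}. 1 / (real i - real k)\<^sup>2)
        + (\<Sum>i\<in>(\<lambda>i. k + i) ` {1..k}. 1 / (real i - real k)\<^sup>2)"
    unfolding split by (rule sum.union_disjoint) auto
  also have "(\<Sum>i\<in>(\<lambda>i. k - i) ` {1..k}. 1 / (real i - real k)\<^sup>2) = (\<Sum>i=1..k. 1 / (real i)\<^sup>2)"
    by (subst sum.reindex) (auto simp: inj_on_def of_nat_diff intro!: sum.cong)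
  also have "(\<Sum>i\<in>(\<lambda>i. k + i) ` {1..k}. 1 / (real i - real k)\<^sup>2) = (\<Sum>i=1..k. 1 / (real i)\<^sup>2)"
    by (subst sum.reindex) (auto simp: inj_on_def intro!: sum.cong)
  finally show ?thesis using sum_inverse_squares_le[of k] by linarith
qed

lemma abs_trig_sum_le: "\<bar>trig_sum N c x\<bar> \<le> (\<Sum>j\<le>N. cmod (c j))"
proof -
  have "\<bar>Re (c j * cis (real j * x))\<bar> \<le> cmod (c j)" for j
    using abs_Re_le_cmod[of "c j * cis (real j * x)"] by (simp add: norm_mult)
  then show ?thesis unfolding trig_sum_def by (intro order.trans[OF sum_abs] sum_mono)
qed

text \<open>
  A Neumann series in disguise: a finite norm that is bounded by a constant plus \<open>\<theta>\<close> times itself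
  can be solved for.
\<close>

lemma trig_sum_bound_self_improve:
  assumes "\<theta> < 1"
    and improve: "\<And>B. (\<And>x. \<bar>trig_sum N c x\<bar> \<le> B) \<Longrightarrow> (\<And>x. \<bar>trig_sum N c x\<bar> \<le> A + \<theta> * B)"
  shows "\<bar>trig_sum N c x\<bar> \<le> A / (1 - \<theta>)"
proof -
  define B where "B = (SUP x. \<bar>trig_sum N c x\<bar>)"
  have "bdd_above (range (\<lambda>x. \<bar>trig_sum N c x\<bar>))" by (intro bdd_aboveI2[where M = "\<Sum>j\<le>N. cmod (c j)"] abs_trig_sum_le)
  then have le: "\<bar>trig_sum N c x\<bar> \<le> B" for x unfolding B_def by (intro cSUP_upper) auto
  have "B \<le> A + \<theta> * B" unfolding B_def by (rule cSUP_least) (auto intro: improve le[unfolded B_def])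
  then have "B \<le> A / (1 - \<theta>)" using assms(1) by (simp add: pos_le_divide_eq algebra_simps)
  then show ?thesis using le[of x] by linarith
qed

text \<open>
  Averaging the difference with the hat weight and dividing by the central binomial coefficient
  gives a multiplier \<open>W j / C = 1 - u j\<close> for \<open>j \<ge> m\<close>. Each term of \<open>u j\<close> is of order \<open>1 / ((i - k) * j * h)\<^sup>2\<close> with
  a coefficient at most one, so \<open>u\<close> has small norm on frequencies \<open>j \<ge> m\<close> as soon as \<open>m * h\<close> is
  large, uniformly in \<open>k\<close>. There the averaged difference is almost the identity, and the part of
  the sum in these frequencies is bounded by a constant times \<open>\<Omega> / C\<close>.
\<close>

lemma high_frequency_bound:
  assumes "h > 0" "k \<ge> 1" "m \<ge> 1" "0 \<le> \<Omega>" and small: "48 / (real m * h)\<^sup>2 < 1"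
    and \<Omega>: "\<And>s x. s \<in> {0<..h} \<Longrightarrow> \<bar>fin_diff (2 * k) s (trig_sum N c) x\<bar> \<le> \<Omega>"
    and q: "multiplier_bound N q K" "\<And>j. j < m \<Longrightarrow> q j = 0"
  shows "\<bar>trig_sum N (\<lambda>j. q j *\<^sub>R c j) x\<bar>
      \<le> K * (\<Omega> / real (2 * k choose k)) / (1 - 48 / (real m * h)\<^sup>2)"
proof -
  define C where "C = real (2 * k choose k)"
  define t where "t = tangent_inverse_square m"
  define y where "y i = (real i - real k) * h" for i
  define W where "W j = (if j = 0 then 0 else C + (\<Sum>i\<in>off_center k. cos_coeff k i *
        (2 * (1 - cos (real j * y i)) / (real j * y i)\<^sup>2)))" for j :: nat
  \<comment> \<open>For \<open>j \<ge> m\<close> the factor \<open>t j\<close> is \<open>1 / j\<^sup>2\<close>; below \<open>m\<close> its convex continuation keeps the norm small.\<close>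
  define u where "u j = (\<Sum>i\<in>off_center k. (- cos_coeff k i / C * (2 / (y i)\<^sup>2)) * (t j * (1 - cos (real j * y i))))" for j :: nat
  have C: "C > 0" by (simp add: C_def)
  have symbol: "W j / C + u j = 1" if "j \<ge> m" for j
  proof -
    have j: "j > 0" "t j = 1 / (real j)\<^sup>2" using that assms(3) by (auto simp: t_def tangent_inverse_square_def)
    have "u j = - (\<Sum>i\<in>off_center k. cos_coeff k i * (2 * (1 - cos (real j * y i)) / (real j * y i)\<^sup>2)) / C"
      unfolding u_def sum_divide_distrib sum_negf[symmetric] j(2)
      by (intro sum.cong refl) (simp add: power_mult_distrib algebra_simps)
    then show ?thesis using j(1) C by (simp add: W_def add_divide_distrib)
  qed
  have W_integral: "((\<lambda>s. hat h s * (2 - 2 * cos (real j * s)) ^ k) has_integral W j) {0..h}" for j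
    using hat_power_has_integral[OF assms(1), of j k] assms(2)
    by (cases "j = 0") (auto simp: W_def C_def y_def power_0_left)
  have smooth: "\<bar>trig_sum N (\<lambda>j. W j *\<^sub>R c j) x\<bar> \<le> \<Omega>" for x
    by (rule averaged_difference_bound[OF assms(1,2,4) hat_has_integral[OF assms(1)] _ W_integral \<Omega>])
       (use assms(1) in \<open>auto simp: hat_def\<close>)
  have u_bound: "multiplier_bound N u (48 / (real m * h)\<^sup>2)"
  proof -
    have "multiplier_bound N (\<lambda>j. (- cos_coeff k i / C * (2 / (y i)\<^sup>2)) * (t j * (1 + (-1) * cos (real j * y i))))
        (\<bar>- cos_coeff k i / C * (2 / (y i)\<^sup>2)\<bar> * ((3 / (real m)\<^sup>2) * (1 + \<bar>-1\<bar> * 1)))" for i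
      unfolding t_def using assms(3)
      by (intro multiplier_bound_cmult multiplier_bound_compose multiplier_bound_add multiplier_bound_one
          multiplier_bound_cos multiplier_bound_tangent_inverse_square)
    \<comment> \<open>The constant 12 is 2 from the hat, 3 from \<open>t\<close>, and 2 from \<open>1 - cos\<close>.\<close>
    moreover have "\<bar>- cos_coeff k i / C * (2 / (y i)\<^sup>2)\<bar> * ((3 / (real m)\<^sup>2) * (1 + \<bar>-1\<bar> * 1))
        \<le> 12 / (real m * h)\<^sup>2 * (1 / (real i - real k)\<^sup>2)" for i
    proof -
      have "\<bar>cos_coeff k i\<bar> / C \<le> 1" using abs_cos_coeff_le[of k i] C by (simp add: C_def)
      then have "\<bar>cos_coeff k i\<bar> / C * (12 / ((real m)\<^sup>2 * (y i)\<^sup>2)) \<le> 1 * (12 / ((real m)\<^sup>2 * (y i)\<^sup>2))"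
        by (intro mult_right_mono) auto
      then show ?thesis using C by (simp add: abs_mult y_def power_mult_distrib mult_ac)
    qed
    ultimately have "multiplier_bound N (\<lambda>j. (- cos_coeff k i / C * (2 / (y i)\<^sup>2)) * (t j * (1 + (-1) * cos (real j * y i))))
        (12 / (real m * h)\<^sup>2 * (1 / (real i - real k)\<^sup>2))" for i
      by (rule multiplier_bound_mono)
    then have "multiplier_bound N
        (\<lambda>j. \<Sum>i\<in>off_center k. (- cos_coeff k i / C * (2 / (y i)\<^sup>2)) * (t j * (1 + (-1) * cos (real j * y i))))
        (\<Sum>i\<in>off_center k. 12 / (real m * h)\<^sup>2 * (1 / (real i - real k)\<^sup>2))"
      by (intro multiplier_bound_sum) auto
    moreover have "(\<Sum>i\<in>off_center k. 12 / (real m * h)\<^sup>2 * (1 / (real i - real k)\<^sup>2)) \<le> 48 / (real m * h)\<^sup>2"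
      unfolding sum_distrib_left[symmetric]
      using mult_left_mono[OF sum_off_center_inverse_squares_le[of k], of "12 / (real m * h)\<^sup>2"] by simp
    ultimately have "multiplier_bound N
        (\<lambda>j. \<Sum>i\<in>off_center k. (- cos_coeff k i / C * (2 / (y i)\<^sup>2)) * (t j * (1 + (-1) * cos (real j * y i))))
        (48 / (real m * h)\<^sup>2)" by (rule multiplier_bound_mono)
    then show ?thesis by (simp add: u_def[abs_def])
  qed
  have "\<bar>trig_sum N (\<lambda>j. q j *\<^sub>R c j) x\<bar> \<le> K * (\<Omega> / C) + 48 / (real m * h)\<^sup>2 * B"
    if B: "\<And>x. \<bar>trig_sum N (\<lambda>j. q j *\<^sub>R c j) x\<bar> \<le> B" for B x
  proof -
    have "\<bar>trig_sum N (\<lambda>j. (1 / C) *\<^sub>R (W j *\<^sub>R c j)) x\<bar> \<le> \<Omega> / C" for x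
      using smooth[of x] C unfolding trig_sum_scaleR by (simp add: abs_mult divide_right_mono)
    then have 1: "\<bar>trig_sum N (\<lambda>j. q j *\<^sub>R ((1 / C) *\<^sub>R (W j *\<^sub>R c j))) x\<bar> \<le> K * (\<Omega> / C)"
      by (rule multiplier_boundD[OF q(1)])
    have 2: "\<bar>trig_sum N (\<lambda>j. u j *\<^sub>R (q j *\<^sub>R c j)) x\<bar> \<le> 48 / (real m * h)\<^sup>2 * B"
      by (rule multiplier_boundD[OF u_bound B])
    have "trig_sum N (\<lambda>j. q j *\<^sub>R c j) x
        = trig_sum N (\<lambda>j. q j *\<^sub>R ((1 / C) *\<^sub>R (W j *\<^sub>R c j)) + u j *\<^sub>R (q j *\<^sub>R c j)) x"
    proof (rule trig_sum_cong)
      fix j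
      show "q j *\<^sub>R c j = q j *\<^sub>R ((1 / C) *\<^sub>R (W j *\<^sub>R c j)) + u j *\<^sub>R (q j *\<^sub>R c j)"
      proof (cases "j < m")
        case False
        then have "q j * (W j / C + u j) = q j" using symbol[of j] by simp
        then have "q j *\<^sub>R c j = (q j * (W j / C + u j)) *\<^sub>R c j" by simp
        also have "\<dots> = (q j * ((1 / C) * W j) + u j * q j) *\<^sub>R c j" by (simp add: algebra_simps)
        also have "\<dots> = q j *\<^sub>R ((1 / C) *\<^sub>R (W j *\<^sub>R c j)) + u j *\<^sub>R (q j *\<^sub>R c j)"
          by (simp add: scaleR_add_left)
        finally show ?thesis .
      qed (simp add: q(2))
    qed
    then show ?thesis using 1 2 unfolding trig_sum_add by linarith
  qed
  then have "\<bar>trig_sum N (\<lambda>j. q j *\<^sub>R c j) x\<bar> \<le> K * (\<Omega> / C) / (1 - 48 / (real m * h)\<^sup>2)"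
    by (rule trig_sum_bound_self_improve[OF small])
  then show ?thesis by (simp add: C_def)
qed

section \<open>The primitive of a power of the sine\<close>

text \<open>
  The primitive of \<open>(2 - 2 * cos (2 * y)) ^ k\<close> that vanishes at zero. The explicit form shows that
  the oscillating terms vanish at the multiples of \<open>pi / 2\<close>.
\<close>

definition cos_primitive :: "nat \<Rightarrow> real \<Rightarrow> real" where
  "cos_primitive k y = real (2 * k choose k) * y
     + (\<Sum>i\<in>off_center k. cos_coeff k i * (sin ((real i - real k) * (2 * y)) / ((real i - real k) * 2)))"

lemma DERIV_cos_primitive:
  "(cos_primitive k has_real_derivative (2 - 2 * cos (2 * y)) ^ k) (at y within A)"
proof -
  have sine: "((\<lambda>y. sin (d * (2 * y)) / (d * 2)) has_real_derivative cos (d * (2 * y))) (at y within A)"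
    if "d \<noteq> 0" for d
    using that by (auto intro!: derivative_eq_intros)
  show ?thesis
    unfolding cos_primitive_def[abs_def] cos_expansion
    by (intro DERIV_add DERIV_sum DERIV_cmult DERIV_cmult_Id sine off_center_neq)
qed

lemma cos_primitive_half_pi:
  "cos_primitive k (real p * (pi / 2)) = real (2 * k choose k) * (real p * (pi / 2))"
proof -
  have "sin ((real i - real k) * (2 * (real p * (pi / 2)))) = 0" for i
  proof -
    have "(real i - real k) * (2 * (real p * (pi / 2))) = pi * of_int ((int i - int k) * int p)"
      by simp
    then show ?thesis by (simp only: sin_npi_int)
  qed
  then show ?thesis by (simp add: cos_primitive_def)
qed

lemma cos_weight_bounds:
  "0 \<le> (2 - 2 * cos y) ^ k" "(2 - 2 * cos y) ^ k \<le> (4 :: real) ^ k"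
proof -
  have "0 \<le> 2 - 2 * cos y" "2 - 2 * cos y \<le> 4" using cos_le_one[of y] cos_ge_minus_one[of y] by linarith+
  then show "0 \<le> (2 - 2 * cos y) ^ k" "(2 - 2 * cos y) ^ k \<le> 4 ^ k" by (auto intro: power_mono)
qed

lemma cos_primitive_increment:
  assumes "x \<le> y"
  shows "0 \<le> cos_primitive k y - cos_primitive k x"
    and "cos_primitive k y - cos_primitive k x \<le> 4 ^ k * (y - x)"
proof -
  have "cos_primitive k x \<le> cos_primitive k y"
    using assms by (rule DERIV_nonneg_imp_nondecreasing)
      (use DERIV_cos_primitive cos_weight_bounds(1) in blast)
  then show "0 \<le> cos_primitive k y - cos_primitive k x" by simp
  have "((\<lambda>v. 4 ^ k * v - cos_primitive k v) has_real_derivative 4 ^ k - (2 - 2 * cos (2 * v)) ^ k) (at v)" for v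
    by (auto intro!: derivative_eq_intros DERIV_cos_primitive)
  then have "4 ^ k * x - cos_primitive k x \<le> 4 ^ k * y - cos_primitive k y"
    by (intro DERIV_nonneg_imp_nondecreasing[OF assms]) (use cos_weight_bounds(2) in \<open>force\<close>)
  then show "cos_primitive k y - cos_primitive k x \<le> 4 ^ k * (y - x)" by (simp add: algebra_simps)
qed

text \<open>
  The integrand is \<open>(4 * (sin v)\<^sup>2) ^ k\<close>, which increases and decreases in turn between
  consecutive multiples of \<open>pi / 2\<close>.
\<close>

lemma cos_weight_monotone:
  assumes "real i * pi \<le> 2 * v" "2 * (v + e) \<le> real (i + 1) * pi" "0 \<le> e"
  shows "0 \<le> (-1) ^ i * ((2 - 2 * cos (2 * (v + e))) ^ k - (2 - 2 * cos (2 * v)) ^ k)"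
proof -
  have "0 \<le> sin (2 * v + e - real i * pi)"
    using assms by (intro sin_ge_zero) (auto simp: algebra_simps)
  also have "sin (2 * v + e - real i * pi) = (-1) ^ i * sin (2 * v + e)"
    by (simp add: sin_diff)
  finally have sign: "0 \<le> (-1) ^ i * sin (2 * v + e)" .
  have "2 * e \<le> pi" using assms by (simp add: algebra_simps)
  then have "0 \<le> sin e" using assms by (intro sin_ge_zero) auto
  have "cos (2 * v) - cos (2 * (v + e)) = 2 * sin (2 * v + e) * sin e"
    by (subst cos_diff_cos) (simp add: algebra_simps add_divide_distrib)
  moreover have "(2 - 2 * cos (2 * (v + e))) - (2 - 2 * cos (2 * v)) = 2 * (cos (2 * v) - cos (2 * (v + e)))"
    by simp
  ultimately have *: "(2 - 2 * cos (2 * (v + e))) - (2 - 2 * cos (2 * v)) = 4 * sin e * sin (2 * v + e)"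
    by (simp only: mult_ac)
  have nn: "0 \<le> 2 - 2 * cos (2 * v)" "0 \<le> 2 - 2 * cos (2 * (v + e))" by simp_all
  show ?thesis
  proof (cases "even i")
    case True
    then have "0 \<le> 4 * sin e * sin (2 * v + e)" using sign \<open>0 \<le> sin e\<close> by simp
    with * have "2 - 2 * cos (2 * v) \<le> 2 - 2 * cos (2 * (v + e))" by linarith
    from power_mono[OF this nn(1)] True show ?thesis by simp
  next
    case False
    then have "4 * sin e * sin (2 * v + e) \<le> 0" using sign \<open>0 \<le> sin e\<close>
      by (simp add: mult_nonneg_nonpos)
    with * have "2 - 2 * cos (2 * (v + e)) \<le> 2 - 2 * cos (2 * v)" by linarith
    from power_mono[OF this nn(2)] False show ?thesis by simp
  qed
qed

lemma cos_primitive_second_difference_sign: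
  assumes "real i * pi \<le> 2 * y" "2 * (y + 2 * e) \<le> real (i + 1) * pi" "0 \<le> e"
  shows "0 \<le> (-1) ^ i * ((cos_primitive k (y + 2 * e) - cos_primitive k (y + e))
                          - (cos_primitive k (y + e) - cos_primitive k y))"
proof -
  define F where "F v = (-1) ^ i * (cos_primitive k (v + e) - cos_primitive k v)" for v
  have F': "(F has_real_derivative
      (-1) ^ i * ((2 - 2 * cos (2 * (v + e))) ^ k - (2 - 2 * cos (2 * v)) ^ k)) (at v)" for v
    unfolding F_def
    by (intro DERIV_cmult DERIV_diff DERIV_cos_primitive DERIV_shift[THEN iffD1])
  have "F y \<le> F (y + e)"
  proof (rule DERIV_nonneg_imp_nondecreasing[of y "y + e" F])
    fix v assume "y \<le> v" "v \<le> y + e"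
    then have "0 \<le> (-1) ^ i * ((2 - 2 * cos (2 * (v + e))) ^ k - (2 - 2 * cos (2 * v)) ^ k)"
      using assms by (intro cos_weight_monotone) auto
    with F' show "\<exists>d. (F has_real_derivative d) (at v) \<and> 0 \<le> d" by blast
  qed (use assms in simp)
  then show ?thesis by (simp add: F_def algebra_simps)
qed

text \<open>
  On a grid that contains the multiples of \<open>pi / 2\<close>, the increments of the primitive are monotone
  within each of the \<open>b\<close> blocks, so their variation telescopes. A bound on the derivative of the
  integrand would lose a factor \<open>sqrt k\<close> here.
\<close>

lemma cos_primitive_variation:
  fixes D :: "nat \<Rightarrow> real"
  assumes n: "n \<ge> 1" "real n * e = pi / 2"
    and D: "\<And>l. D l = cos_primitive k (real (l + 1) * e) - cos_primitive k (real l * e)"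
  shows "(\<Sum>l<b * n. \<bar>D (l + 1) - D l\<bar>) \<le> real b * (2 * (4 ^ k * e))"
proof -
  have e: "e > 0"
  proof -
    have "real n * e > 0" unfolding n(2) by simp
    then show ?thesis using n(1) by (simp add: zero_less_mult_iff)
  qed
  have D_bounds: "0 \<le> D l" "D l \<le> 4 ^ k * e" for l
    using cos_primitive_increment[of "real l * e" "real (l + 1) * e" k] e
    by (simp_all add: D algebra_simps)
  have block: "(\<Sum>l=i * n..<i * n + n. \<bar>D (l + 1) - D l\<bar>) \<le> 2 * (4 ^ k * e)" for i
  proof -
    \<comment> \<open>The last difference of a block straddles two blocks; it is estimated separately.\<close>
    obtain n' where n': "n = Suc n'" using n(1) by (cases n) auto
    have sign: "\<bar>D (l + 1) - D l\<bar> = (-1) ^ i * (D (l + 1) - D l)" if l: "l \<in> {i * n..<i * n + n'}" for l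
    proof -
      have 1: "real i * pi \<le> 2 * (real l * e)"
      proof -
        have "i * n \<le> l" using l by simp
        then have "real (i * n) * e \<le> real l * e" using e by (intro mult_right_mono) (auto simp only: of_nat_le_iff)
        moreover have "real (i * n) * e = real i * (pi / 2)" unfolding n(2)[symmetric] by simp
        ultimately show ?thesis by linarith
      qed
      have 2: "2 * (real l * e + 2 * e) \<le> real (i + 1) * pi"
      proof -
        have "l + 2 \<le> (i + 1) * n" using l n' by simp
        then have "real (l + 2) * e \<le> real ((i + 1) * n) * e" using e by (intro mult_right_mono) (auto simp only: of_nat_le_iff)
        moreover have "real ((i + 1) * n) * e = real (i + 1) * (pi / 2)"
          unfolding n(2)[symmetric] by (simp add: algebra_simps)
        ultimately show ?thesis by (simp add: algebra_simps)
      qed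
      have "0 \<le> (-1) ^ i * (D (l + 1) - D l)"
        using cos_primitive_second_difference_sign[OF 1 2, of k] e by (simp add: D algebra_simps)
      then show ?thesis by (cases "even i") auto
    qed
    have "(\<Sum>l=i * n..<i * n + n. \<bar>D (l + 1) - D l\<bar>)
        = (\<Sum>l=i * n..<i * n + n'. (-1) ^ i * (D (l + 1) - D l)) + \<bar>D (i * n + n' + 1) - D (i * n + n')\<bar>"
      using sign n' by simp
    also have "(\<Sum>l=i * n..<i * n + n'. (-1) ^ i * (D (l + 1) - D l)) = (-1) ^ i * (D (i * n + n') - D (i * n))"
      unfolding sum_distrib_left[symmetric] using sum_Suc_diff'[of "i * n" "i * n + n'" D] by simp
    also have "\<dots> \<le> \<bar>D (i * n + n') - D (i * n)\<bar>" by (cases "even i") auto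
    finally show ?thesis
      using D_bounds[of "i * n + n' + 1"] D_bounds[of "i * n + n'"] D_bounds[of "i * n"] by linarith
  qed
  have "(\<Sum>l<b * n. \<bar>D (l + 1) - D l\<bar>) = (\<Sum>i<b. \<Sum>l=i * n..<i * n + n. \<bar>D (l + 1) - D l\<bar>)"
    by (rule sum.nat_group[symmetric])
  also have "\<dots> \<le> (\<Sum>i<b. 2 * (4 ^ k * e))" by (intro sum_mono block)
  finally show ?thesis by simp
qed

text \<open>
  The second difference of \<open>1 / S\<close> splits into the second difference of \<open>S\<close>, divided by a product of
  values, and a first difference of \<open>1 / S\<close> times a relative increment. The latter telescopes.
\<close>

lemma reciprocal_second_difference_sum:
  fixes S :: "nat \<Rightarrow> real"
  assumes "\<sigma> > 0" and S: "\<And>l. \<sigma> \<le> S l" "\<And>l. S l \<le> S (l + 1)" "\<And>l. S (l + 1) - S l \<le> G"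
  shows "(\<Sum>l=1..K. \<bar>1 / S (l - 1) - 2 * (1 / S l) + 1 / S (l + 1)\<bar>)
    \<le> ((\<Sum>l=1..K. \<bar>(S (l + 1) - S l) - (S l - S (l - 1))\<bar>) + 2 * G) / \<sigma>\<^sup>2"
proof -
  have G: "G \<ge> 0" using S(2,3)[of 0] by linarith
  have pos: "S l > 0" for l using S(1)[of l] assms(1) by linarith
  have recip: "1 / S l \<le> 1 / \<sigma>" "0 < 1 / S l" for l using S(1)[of l] assms(1) pos by (auto intro: divide_left_mono)
  have "\<bar>1 / S (l - 1) - 2 * (1 / S l) + 1 / S (l + 1)\<bar>
      \<le> \<bar>(S (l + 1) - S l) - (S l - S (l - 1))\<bar> / \<sigma>\<^sup>2 + G / \<sigma> * (1 / S (l - 1) - 1 / S (l + 1))"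
    if l: "l \<in> {1..K}" for l
  proof -
    define a b c where "a = S (l - 1)" "b = S l" "c = S (l + 1)"
    have abc: "0 < a" "0 < b" "0 < c" "\<sigma> \<le> a" "\<sigma> \<le> b" "a \<le> b" "b \<le> c" "c - b \<le> G"
      using pos S l S(2)[of "l - 1"] by (auto simp: a_b_c_def)
    have "1 / a - 2 * (1 / b) + 1 / c = ((b - a) - (c - b)) / (a * b) + (c - b) / b * (1 / a - 1 / c)"
      using abc by (simp add: field_simps)
    also have "\<bar>\<dots>\<bar> \<le> \<bar>((b - a) - (c - b)) / (a * b)\<bar> + \<bar>(c - b) / b * (1 / a - 1 / c)\<bar>" by (rule abs_triangle_ineq)
    also have "\<bar>((b - a) - (c - b)) / (a * b)\<bar> \<le> \<bar>(c - b) - (b - a)\<bar> / \<sigma>\<^sup>2"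
    proof -
      have "\<sigma>\<^sup>2 \<le> a * b" unfolding power2_eq_square using abc assms(1) by (intro mult_mono) auto
      then have "\<bar>(c - b) - (b - a)\<bar> / (a * b) \<le> \<bar>(c - b) - (b - a)\<bar> / \<sigma>\<^sup>2"
        using assms(1) abc by (intro divide_left_mono) auto
      moreover have "\<bar>((b - a) - (c - b)) / (a * b)\<bar> = \<bar>(c - b) - (b - a)\<bar> / (a * b)"
        using abc abs_minus_commute[of "b - a" "c - b"] by (simp only: abs_divide abs_mult abs_of_pos)
      ultimately show ?thesis by linarith
    qed
    also have "\<bar>(c - b) / b * (1 / a - 1 / c)\<bar> \<le> G / \<sigma> * (1 / a - 1 / c)"
    proof -
      have ac: "0 \<le> 1 / a - 1 / c" using abc by (simp add: divide_left_mono)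
      have "(c - b) / b \<le> G / \<sigma>" using abc assms(1) by (intro frac_le) auto
      moreover have "0 \<le> (c - b) / b" using abc by simp
      ultimately show ?thesis
        using mult_right_mono[of "(c - b) / b" "G / \<sigma>" "1 / a - 1 / c"] ac
        unfolding abs_mult by (simp only: abs_of_nonneg)
    qed
    finally show ?thesis by (simp add: a_b_c_def)
  qed
  then have "(\<Sum>l=1..K. \<bar>1 / S (l - 1) - 2 * (1 / S l) + 1 / S (l + 1)\<bar>)
      \<le> (\<Sum>l=1..K. \<bar>(S (l + 1) - S l) - (S l - S (l - 1))\<bar> / \<sigma>\<^sup>2 + G / \<sigma> * (1 / S (l - 1) - 1 / S (l + 1)))"
    by (rule sum_mono)
  also have "\<dots> = (\<Sum>l=1..K. \<bar>(S (l + 1) - S l) - (S l - S (l - 1))\<bar>) / \<sigma>\<^sup>2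
      + G / \<sigma> * (\<Sum>l=1..K. 1 / S (l - 1) - 1 / S (l + 1))"
    by (simp only: sum.distrib sum_distrib_left sum_divide_distrib)
  also have "(\<Sum>l=1..K. 1 / S (l - 1) - 1 / S (l + 1)) = 1 / S 0 + 1 / S 1 - 1 / S K - 1 / S (K + 1)"
    by (induction K) auto
  also have "G / \<sigma> * \<dots> \<le> G / \<sigma> * (2 / \<sigma>)"
  proof (rule mult_left_mono)
    have "2 / \<sigma> = 1 / \<sigma> + 1 / \<sigma>" by simp
    then show "1 / S 0 + 1 / S 1 - 1 / S K - 1 / S (K + 1) \<le> 2 / \<sigma>"
      using recip[of 0] recip[of 1] recip[of K] recip[of "K + 1"] by linarith
  qed (use G assms(1) in simp)
  also have "G / \<sigma> * (2 / \<sigma>) = 2 * G / \<sigma>\<^sup>2" by (simp add: power2_eq_square)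
  finally show ?thesis by (simp add: add_divide_distrib)
qed

section \<open>Middle frequencies\<close>

text \<open>
  Induction on \<open>k\<close>: the step is the inequality between the geometric and the arithmetic mean of
  \<open>k\<close> and \<open>k + 1\<close>.
\<close>

lemma four_power_le_central_binomial:
  assumes "k \<ge> 1"
  shows "4 ^ k \<le> 2 * sqrt (real k) * real (2 * k choose k)"
  using assms
proof (induction k rule: dec_induct)
  case base
  show ?case by simp
next
  case (step k)
  have rec: "real (Suc k) * real (2 * Suc k choose Suc k) = 2 * (2 * real k + 1) * real (2 * k choose k)"
  proof -
    have "Suc k * (2 * Suc k choose Suc k) = 2 * Suc (2 * k) * (2 * k choose k)"
    proof -
      have "Suc (2 * k) choose k = Suc (2 * k) choose Suc k"
        using binomial_symmetric[of k "Suc (2 * k)"] by simp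
      then have "2 * Suc k choose Suc k = 2 * (Suc (2 * k) choose Suc k)"
        using binomial_Suc_Suc[of "Suc (2 * k)" k] by simp
      moreover have "Suc k * (Suc (2 * k) choose Suc k) = Suc (2 * k) * (2 * k choose k)"
        using Suc_times_binomial_eq[of "2 * k" k] by (simp only: mult.commute)
      ultimately show ?thesis by (simp only: mult.assoc mult.left_commute)
    qed
    then have "real (Suc k * (2 * Suc k choose Suc k)) = real (2 * Suc (2 * k) * (2 * k choose k))" by (rule arg_cong)
    then show ?thesis by (simp only: of_nat_mult of_nat_Suc of_nat_numeral) (simp add: algebra_simps)
  qed
  have amgm: "2 * sqrt (real k) * sqrt (real (Suc k)) \<le> 2 * real k + 1"
  proof -
    have "0 \<le> (sqrt (real (Suc k)) - sqrt (real k))\<^sup>2" by simp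
    also have "\<dots> = real (Suc k) + real k - 2 * sqrt (real k) * sqrt (real (Suc k))"
      by (simp add: power2_diff)
    finally show ?thesis by simp
  qed
  have sqrt: "real (Suc k) = sqrt (real (Suc k)) * sqrt (real (Suc k))" by simp
  have "real (Suc k) * 4 ^ Suc k \<le> real (Suc k) * (4 * (2 * sqrt (real k) * real (2 * k choose k)))"
    using step by (intro mult_left_mono) auto
  also have "\<dots> = 4 * sqrt (real (Suc k)) * real (2 * k choose k) * (2 * sqrt (real k) * sqrt (real (Suc k)))"
    by (subst sqrt) (simp only: mult_ac)
  also have "\<dots> \<le> 4 * sqrt (real (Suc k)) * real (2 * k choose k) * (2 * real k + 1)"
    by (intro mult_left_mono amgm) auto
  also have "\<dots> = 2 * sqrt (real (Suc k)) * (2 * (2 * real k + 1) * real (2 * k choose k))"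
    by (simp add: algebra_simps)
  also have "\<dots> = real (Suc k) * (2 * sqrt (real (Suc k)) * real (2 * Suc k choose Suc k))"
    unfolding rec[symmetric] by (simp only: mult_ac)
  finally show ?case by simp
qed

lemma one_le_central_binomial: "1 \<le> real (2 * k choose k)"
proof -
  have "0 < 2 * k choose k" by simp
  then show ?thesis by linarith
qed

lemma central_binomial_le: "real (2 * k choose k) \<le> 4 ^ k"
proof -
  have "real (2 * k choose k) \<le> real (2 ^ (2 * k))"
    by (intro of_nat_mono) (rule binomial_le_pow2)
  then show ?thesis by (simp add: power_mult)
qed

text \<open>
  Frequencies are clamped to \<open>{n..6 * n}\<close>, where the primitive is at least its value
  \<open>\<sigma>\<close> at \<open>pi / 2\<close>. The increments of the clamped sequence \<open>S\<close> have variation at most 14 times the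
  largest possible increment \<open>G\<close>: 12 from the six blocks of length \<open>n\<close>, and 1 from each of the two
  ends where the clamping starts. The weight \<open>l\<close> in the second difference bound is at most \<open>6 * n\<close>,
  and \<open>n * G\<close> is of order \<open>4 ^ k\<close>, while \<open>\<sigma>\<close> is of order \<open>2 * k choose k\<close>.
\<close>

lemma multiplier_bound_reciprocal_primitive:
  assumes "n \<ge> 1" "real n * e = pi / 2" "k \<ge> 1"
  shows "multiplier_bound N (\<lambda>j. 1 / cos_primitive k (real (max n (min j (6 * n))) * e))
           (65 * 4 ^ k / (real (2 * k choose k))\<^sup>2)"
proof -
  define C where "C = real (2 * k choose k)"
  define \<sigma> where "\<sigma> = C * (pi / 2)"
  define G where "G = 4 ^ k * e"
  define D where "D l = cos_primitive k (real (l + 1) * e) - cos_primitive k (real l * e)" for l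
  define S where "S l = cos_primitive k (real (max n (min l (6 * n))) * e)" for l
  define \<delta> where "\<delta> l = 1 / S (l - 1) - 2 * (1 / S l) + 1 / S (l + 1)" for l
  have e: "e > 0"
  proof -
    have "real n * e > 0" unfolding assms(2) by simp
    then show ?thesis using assms(1) by (simp add: zero_less_mult_iff)
  qed
  have C: "C \<ge> 1" "C \<le> 4 ^ k"
    unfolding C_def using one_le_central_binomial central_binomial_le by blast+
  have \<sigma>: "\<sigma> > 0" using C by (simp add: \<sigma>_def)
  have D_bounds: "0 \<le> D l" "D l \<le> G" for l
    using cos_primitive_increment[of "real l * e" "real (l + 1) * e" k] e
    by (simp_all add: D_def G_def algebra_simps)
  have S_diff: "S (l + 1) - S l = (if n \<le> l \<and> l < 6 * n then D l else 0)" for l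
  proof -
    have "max n (min (l + 1) (6 * n)) = (if n \<le> l \<and> l < 6 * n then l + 1 else max n (min l (6 * n)))"
      by auto
    moreover have "n \<le> l \<and> l < 6 * n \<Longrightarrow> max n (min l (6 * n)) = l" by auto
    ultimately show ?thesis by (auto simp: S_def D_def)
  qed
  have S_lower: "\<sigma> \<le> S l" for l
  proof -
    have "cos_primitive k (real n * e) = \<sigma>"
      unfolding assms(2) using cos_primitive_half_pi[of k 1] by (simp add: \<sigma>_def C_def)
    moreover have "real n * e \<le> real (max n (min l (6 * n))) * e" using e by (intro mult_right_mono) auto
    ultimately show ?thesis using cos_primitive_increment(1)[of "real n * e" _ k] by (force simp: S_def)
  qed
  have S_mono: "S l \<le> S (l + 1)" for l
    using S_diff[of l] D_bounds(1)[of l] by (auto split: if_splits)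
  have S_incr: "S (l + 1) - S l \<le> G" for l
    using S_diff[of l] D_bounds[of l] by (auto split: if_splits)
  have "(\<Sum>l=1..6 * n. \<bar>(S (l + 1) - S l) - (S l - S (l - 1))\<bar>)
      \<le> (\<Sum>l=1..6 * n. \<bar>D l - D (l - 1)\<bar> + ((if l = n then G else 0) + (if l = 6 * n then G else 0)))"
  proof (rule sum_mono)
    fix l assume l: "l \<in> {1..6 * n}"
    then have "S l - S (l - 1) = (if n \<le> l - 1 \<and> l - 1 < 6 * n then D (l - 1) else 0)"
      using S_diff[of "l - 1"] by simp
    then show "\<bar>(S (l + 1) - S l) - (S l - S (l - 1))\<bar>
        \<le> \<bar>D l - D (l - 1)\<bar> + ((if l = n then G else 0) + (if l = 6 * n then G else 0))"
      unfolding S_diff using D_bounds[of l] D_bounds[of "l - 1"] l assms(1) by auto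
  qed
  also have "\<dots> = (\<Sum>l=1..6 * n. \<bar>D l - D (l - 1)\<bar>) + 2 * G"
    using assms(1) by (simp add: sum.distrib)
  also have "(\<Sum>l=1..6 * n. \<bar>D l - D (l - 1)\<bar>) = (\<Sum>l<6 * n. \<bar>D (l + 1) - D l\<bar>)"
    by (simp add: sum.atLeast1_atMost_eq)
  also have "\<dots> \<le> real 6 * (2 * (4 ^ k * e))"
    by (rule cos_primitive_variation[OF assms(1,2) D_def])
  finally have var: "(\<Sum>l=1..6 * n. \<bar>(S (l + 1) - S l) - (S l - S (l - 1))\<bar>) \<le> 14 * G"
    unfolding G_def by linarith
  have "(\<Sum>l=1..6 * n. real l * \<bar>\<delta> l\<bar>) \<le> (\<Sum>l=1..6 * n. real (6 * n) * \<bar>\<delta> l\<bar>)"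
    by (intro sum_mono mult_right_mono) auto
  also have "\<dots> = real (6 * n) * (\<Sum>l=1..6 * n. \<bar>\<delta> l\<bar>)" by (simp add: sum_distrib_left)
  also have "\<dots> \<le> real (6 * n) * (((\<Sum>l=1..6 * n. \<bar>(S (l + 1) - S l) - (S l - S (l - 1))\<bar>) + 2 * G) / \<sigma>\<^sup>2)"
    unfolding \<delta>_def
    by (intro mult_left_mono reciprocal_second_difference_sum \<sigma> S_lower S_mono S_incr) auto
  also have "\<dots> \<le> real (6 * n) * (16 * G / \<sigma>\<^sup>2)"
  proof (intro mult_left_mono divide_right_mono)
    show "(\<Sum>l=1..6 * n. \<bar>(S (l + 1) - S l) - (S l - S (l - 1))\<bar>) + 2 * G \<le> 16 * G"
      using var by linarith
  qed auto
  also have "\<dots> = 96 * 4 ^ k * (real n * e) / \<sigma>\<^sup>2" by (simp add: G_def)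
  also have "\<dots> = 192 / pi * (4 ^ k / C\<^sup>2)"
    unfolding assms(2) \<sigma>_def by (simp add: power2_eq_square field_simps)
  also have "\<dots> \<le> 64 * (4 ^ k / C\<^sup>2)"
    using pi_gt3 by (intro mult_right_mono) (auto simp: field_simps)
  finally have total: "(\<Sum>l=1..6 * n. real l * \<bar>\<delta> l\<bar>) \<le> 64 * (4 ^ k / C\<^sup>2)" .
  have "\<bar>1 / S (6 * n)\<bar> \<le> 1 / \<sigma>" using S_lower[of "6 * n"] \<sigma> by (simp add: frac_le)
  also have "\<dots> \<le> 1 / C" using C pi_gt3 by (intro divide_left_mono) (auto simp: \<sigma>_def)
  also have "\<dots> = C / C\<^sup>2" by (simp add: power2_eq_square)
  also have "\<dots> \<le> 4 ^ k / C\<^sup>2" using C by (intro divide_right_mono) auto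
  finally have last: "\<bar>1 / S (6 * n)\<bar> \<le> 4 ^ k / C\<^sup>2" .
  have const: "1 / S j = 1 / S (6 * n)" if "j \<ge> 6 * n" for j using that by (simp add: S_def)
  have "multiplier_bound N (\<lambda>j. 1 / S j) (\<bar>1 / S (6 * n)\<bar> + (\<Sum>l=1..6 * n. real l * \<bar>\<delta> l\<bar>))"
    unfolding \<delta>_def by (rule multiplier_bound_second_difference[of "6 * n" "\<lambda>j. 1 / S j" N, OF const])
  then have "multiplier_bound N (\<lambda>j. 1 / S j) (65 * 4 ^ k / C\<^sup>2)"
    by (rule multiplier_bound_mono) (use total last in simp)
  then show ?thesis by (simp add: S_def C_def)
qed

lemma box_power_has_integral:
  assumes "h > 0" "j > 0"
  shows "((\<lambda>s. 1 / h * (2 - 2 * cos (real j * s)) ^ k) has_integral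
            1 / h * (2 / real j * cos_primitive k (real j * (h / 2)))) {0..h}"
proof -
  define F where "F s = 2 / real j * cos_primitive k (real j / 2 * s)" for s
  have "(F has_real_derivative (2 - 2 * cos (real j * s)) ^ k) (at s within {0..h})" for s
  proof -
    have "((\<lambda>s. cos_primitive k (real j / 2 * s)) has_real_derivative
        (2 - 2 * cos (2 * (real j / 2 * s))) ^ k * (real j / 2)) (at s within {0..h})"
      by (rule DERIV_chain2[OF DERIV_cos_primitive]) (auto intro!: derivative_eq_intros)
    from DERIV_cmult[OF this, of "2 / real j"] show ?thesis unfolding F_def using assms(2) by simp
  qed
  then have "((\<lambda>s. (2 - 2 * cos (real j * s)) ^ k) has_integral F h - F 0) {0..h}"
    using assms by (intro fundamental_theorem_of_calculus)
      (auto simp flip: has_real_derivative_iff_has_vector_derivative)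
  then have "((\<lambda>s. 1 / h * (2 - 2 * cos (real j * s)) ^ k) has_integral 1 / h * (F h - F 0)) {0..h}"
    by (rule has_integral_mult_right)
  moreover have "F h - F 0 = 2 / real j * cos_primitive k (real j * (h / 2))"
    by (simp add: F_def cos_primitive_def)
  ultimately show ?thesis by simp
qed

text \<open>
  With the uniform weight the averaged difference is the multiplier
  \<open>W j = 2 / (j * h) * cos_primitive k (j * h / 2)\<close>, which is positive for all \<open>j \<ge> n\<close> and can be
  inverted on \<open>{n..<6 * n}\<close>. The inverse is the product of \<open>L\<close>, linear in \<open>j\<close>, and of the reciprocal
  primitive. Below \<open>n\<close> the coefficients of the result \<open>d\<close> are left free: a polynomial of degree
  less than \<open>n\<close> will absorb them.
\<close>

lemma middle_frequency_bound:
  assumes n: "n \<ge> 1" and "k \<ge> 1" "0 \<le> \<Omega>"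
    and \<Omega>: "\<And>s x. s \<in> {0<..pi / real n} \<Longrightarrow> \<bar>fin_diff (2 * k) s (trig_sum N c) x\<bar> \<le> \<Omega>"
    and p: "multiplier_bound N p K" "\<And>j. j \<ge> 6 * n \<Longrightarrow> p j = 0" and "K \<ge> 0"
  obtains d where "\<And>j. j \<ge> n \<Longrightarrow> d j = p j *\<^sub>R c j"
    "\<And>x. \<bar>trig_sum N d x\<bar> \<le> K * (1235 * 4 ^ k / (real (2 * k choose k))\<^sup>2) * \<Omega>"
proof -
  define C where "C = real (2 * k choose k)"
  define h where "h = pi / real n"
  define R where "R j = 1 / cos_primitive k (real (max n (min j (6 * n))) * (h / 2))" for j
  \<comment> \<open>For \<open>j \<le> 6 * n\<close> this is \<open>pi / 2 * (j / n)\<close>, frozen beyond so that it has finite norm.\<close>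
  define L where "L j = pi / 2 * (6 * 1 + (-6) * (real (6 * n - j) / real (6 * n)))" for j
  define W where "W j = (if j = 0 then 0 else 1 / h * (2 / real j * cos_primitive k (real j * (h / 2))))" for j
  define v where "v j = p j * (L j * R j)" for j
  have h: "h > 0" "real n * (h / 2) = pi / 2" using n by (simp_all add: h_def)
  have C: "C > 0" by (simp add: C_def)
  have "multiplier_bound N L (\<bar>pi / 2\<bar> * (\<bar>6\<bar> * 1 + \<bar>-6\<bar> * 1))"
    unfolding L_def using n
    by (intro multiplier_bound_cmult multiplier_bound_add multiplier_bound_one fejer_multiplier_bound) auto
  \<comment> \<open>\<open>6 * pi \<le> 19\<close>; below, \<open>19 * 65 = 1235\<close>.\<close>
  then have L: "multiplier_bound N L 19"
    by (rule multiplier_bound_mono) (use pi_less_4 pi_approx in simp)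
  have R: "multiplier_bound N R (65 * 4 ^ k / C\<^sup>2)"
    unfolding R_def[abs_def] C_def by (rule multiplier_bound_reciprocal_primitive[OF n h(2) assms(2)])
  have v: "multiplier_bound N v (K * (19 * (65 * 4 ^ k / C\<^sup>2)))"
    unfolding v_def[abs_def] by (intro multiplier_bound_compose p L R)
  have vW: "v j * W j = p j" if j: "j \<ge> n" for j
  proof (cases "j < 6 * n")
    case True
    have "0 < C * (pi / 2)" using C by simp
    also have "\<dots> = cos_primitive k (real n * (h / 2))"
      using cos_primitive_half_pi[of k 1] h(2) by (simp add: C_def)
    also have "\<dots> \<le> cos_primitive k (real j * (h / 2))"
      using cos_primitive_increment(1)[of "real n * (h / 2)" "real j * (h / 2)" k] j h(1) by simp
    finally have pos: "cos_primitive k (real j * (h / 2)) > 0" .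
    have "L j = pi / 2 * (real j / real n)" using n True by (simp add: L_def of_nat_diff field_simps)
    moreover have "R j = 1 / cos_primitive k (real j * (h / 2))" using True j by (simp add: R_def max_def min_def)
    moreover have "W j = 1 / h * (2 / real j * cos_primitive k (real j * (h / 2)))" using n j by (simp add: W_def)
    ultimately have "L j * R j * W j = 1" using pos n j by (simp add: h_def)
    then show ?thesis by (simp add: v_def)
  next
    case False
    then show ?thesis by (simp add: v_def p(2))
  qed
  have W_integral: "((\<lambda>s. 1 / h * (2 - 2 * cos (real j * s)) ^ k) has_integral W j) {0..h}" for j
    using box_power_has_integral[OF h(1), of j k] assms(2)
    by (cases "j = 0") (auto simp: W_def power_0_left)
  have one: "((\<lambda>s. 1 / h) has_integral 1) {0..h}"
    using has_integral_const_real[of "1 / h" 0 h] h by simp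
  have "\<bar>trig_sum N (\<lambda>j. W j *\<^sub>R c j) x\<bar> \<le> \<Omega>" for x
    by (rule averaged_difference_bound[OF h(1) assms(2,3) one _ W_integral])
       (use h(1) \<Omega> in \<open>auto simp: h_def\<close>)
  then have "\<bar>trig_sum N (\<lambda>j. v j *\<^sub>R (W j *\<^sub>R c j)) x\<bar> \<le> K * (19 * (65 * 4 ^ k / C\<^sup>2)) * \<Omega>" for x
    by (rule multiplier_boundD[OF v])
  moreover have "v j *\<^sub>R (W j *\<^sub>R c j) = p j *\<^sub>R c j" if "j \<ge> n" for j
    using vW[OF that] by simp
  ultimately show ?thesis using that[of "\<lambda>j. v j *\<^sub>R (W j *\<^sub>R c j)"] by (simp add: C_def)
qed

section \<open>The inequality for trigonometric sums\<close>

text \<open>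
  The de la Vallee Poussin multiplier \<open>p\<close> is one up to \<open>3 * n\<close> and zero from \<open>6 * n\<close> on. It splits
  the sum into a high part, bounded by a constant times \<open>\<Omega> / (2 * k choose k)\<close>, and a part that
  agrees, from frequency \<open>n\<close> on, with a sum that is larger by the factor
  \<open>4 ^ k / (2 * k choose k) \<le> 2 * sqrt k\<close> at most. This factor is the price for the step size
  \<open>pi / n\<close>.
\<close>

lemma jackson_stechkin_trig_sum:
  assumes n: "n \<ge> 1" and k: "k \<ge> 1" and \<Omega>0: "0 \<le> \<Omega>"
    and \<Omega>: "\<And>s x. s \<in> {0<..pi / real n} \<Longrightarrow> \<bar>fin_diff (2 * k) s (trig_sum N c) x\<bar> \<le> \<Omega>"
  obtains b where "\<And>j. j \<ge> n \<Longrightarrow> b j = 0"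
    "\<And>x. \<bar>trig_sum N c x - trig_sum N b x\<bar> \<le> 7430 * sqrt (real k) * gamma_star (2 * k) * \<Omega>"
proof -
  define C where "C = real (2 * k choose k)"
  define p where "p j = 2 * (real (6 * n - j) / real (6 * n)) + (-1) * (real (3 * n - j) / real (3 * n))" for j
  define q where "q j = 1 + (-1) * p j" for j
  have C: "C > 0" by (simp add: C_def)
  have "multiplier_bound N p (\<bar>2\<bar> * 1 + \<bar>-1\<bar> * 1)"
    unfolding p_def using n
    by (intro multiplier_bound_add multiplier_bound_cmult fejer_multiplier_bound) auto
  then have p: "multiplier_bound N p 3" by simp
  have "multiplier_bound N q (1 + \<bar>-1\<bar> * 3)"
    unfolding q_def by (intro multiplier_bound_add multiplier_bound_cmult multiplier_bound_one p)
  then have q: "multiplier_bound N q 4" by simp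
  have p0: "p j = 0" if "j \<ge> 6 * n" for j using that by (simp add: p_def)
  have q0: "q j = 0" if "j < 3 * n" for j using that n by (simp add: q_def p_def of_nat_diff field_simps)
  \<comment> \<open>The contraction factor 16 / 27 for \<open>m = 3 * n\<close> and \<open>h = pi / n\<close> uses \<open>pi > 3\<close>.\<close>
  have \<theta>: "48 / (real (3 * n) * (pi / real n))\<^sup>2 \<le> 16 / 27"
  proof -
    have "real (3 * n) * (pi / real n) = 3 * pi" using n by simp
    moreover have "81 \<le> (3 * pi)\<^sup>2" using power_mono[of 9 "3 * pi" 2] pi_gt3 by simp
    ultimately show ?thesis by (simp add: divide_le_eq)
  qed
  then have small: "48 / (real (3 * n) * (pi / real n))\<^sup>2 < 1" by linarith
  have high: "\<bar>trig_sum N (\<lambda>j. q j *\<^sub>R c j) x\<bar> \<le> 10 * (\<Omega> / C)" for x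
  proof -
    have "\<bar>trig_sum N (\<lambda>j. q j *\<^sub>R c j) x\<bar> \<le> 4 * (\<Omega> / C) / (1 - 48 / (real (3 * n) * (pi / real n))\<^sup>2)"
      unfolding C_def
      by (rule high_frequency_bound[OF _ k _ \<Omega>0 small \<Omega> q q0]) (use n in auto)
    also have "\<dots> \<le> 4 * (\<Omega> / C) / (11 / 27)"
      using \<theta> \<Omega>0 C by (intro divide_left_mono) auto
    also have "\<dots> \<le> 10 * (\<Omega> / C)"
    proof -
      have "0 \<le> \<Omega> / C" using \<Omega>0 C by simp
      moreover have "4 * y / (11 / 27) \<le> 10 * y" if "0 \<le> y" for y :: real using that by simp
      ultimately show ?thesis by blast
    qed
    finally show ?thesis .
  qed
  obtain d where d: "\<And>j. j \<ge> n \<Longrightarrow> d j = p j *\<^sub>R c j"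
    "\<And>x. \<bar>trig_sum N d x\<bar> \<le> 3 * (1235 * 4 ^ k / C\<^sup>2) * \<Omega>"
    using middle_frequency_bound[OF n k \<Omega>0 \<Omega> p p0] unfolding C_def by auto
  define b where "b j = c j - q j *\<^sub>R c j - d j" for j
  have diff: "trig_sum N c x - trig_sum N b x = trig_sum N (\<lambda>j. q j *\<^sub>R c j) x + trig_sum N d x" for x
    using trig_sum_add[of N b "\<lambda>j. q j *\<^sub>R c j + d j" x] trig_sum_add[of N "\<lambda>j. q j *\<^sub>R c j" d x]
    by (simp add: b_def)
  have ratio: "4 ^ k / C \<le> 2 * sqrt (real k)"
    using four_power_le_central_binomial[OF k] C by (simp add: C_def divide_le_eq)
  have one: "1 \<le> 4 ^ k / C"
    using central_binomial_le[of k] C by (simp add: C_def)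
  show thesis
  proof (rule that)
    show "b j = 0" if "j \<ge> n" for j using d(1)[OF that] by (simp add: b_def q_def algebra_simps)
    fix x
    have "\<bar>trig_sum N c x - trig_sum N b x\<bar> \<le> 10 * 1 * (\<Omega> / C) + 3705 * (4 ^ k / C) * (\<Omega> / C)"
      using high[of x] d(2)[of x] unfolding diff by (simp add: power2_eq_square)
    also have "\<dots> \<le> 10 * (4 ^ k / C) * (\<Omega> / C) + 3705 * (4 ^ k / C) * (\<Omega> / C)"
      using one \<Omega>0 C by (intro add_right_mono mult_right_mono mult_left_mono) auto
    also have "\<dots> = 3715 * (\<Omega> / C) * (4 ^ k / C)" by (simp add: algebra_simps)
    also have "\<dots> \<le> 3715 * (\<Omega> / C) * (2 * sqrt (real k))"
      using ratio \<Omega>0 C by (intro mult_left_mono) auto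
    finally show "\<bar>trig_sum N c x - trig_sum N b x\<bar> \<le> 7430 * sqrt (real k) * gamma_star (2 * k) * \<Omega>"
      by (simp add: gamma_star_def C_def divide_inverse mult_ac)
  qed
qed

section \<open>Density of trigonometric sums\<close>

definition trig_poly :: "(real \<Rightarrow> real) \<Rightarrow> bool" where
  "trig_poly f \<longleftrightarrow> (\<exists>N c. f = trig_sum N c)"

lemma trig_sum_change_degree:
  assumes "\<And>j. M < j \<Longrightarrow> j \<le> N \<Longrightarrow> c j = 0"
  shows "trig_sum N c x = trig_sum M (\<lambda>j. if j \<le> N then c j else 0) x"
  unfolding trig_sum_def by (rule sum.mono_neutral_cong) (use assms in auto)

lemma trig_poly_harmonic: "trig_poly (\<lambda>x. Re (a * cis (real m * x)))"
proof -
  have "(\<lambda>x. Re (a * cis (real m * x))) = trig_sum m (\<lambda>j. if j = m then a else 0)"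
  proof
    fix x
    have "trig_sum m (\<lambda>j. if j = m then a else 0) x
        = (\<Sum>j\<le>m. if j = m then Re (a * cis (real m * x)) else 0)"
      unfolding trig_sum_def by (intro sum.cong refl) simp
    then show "Re (a * cis (real m * x)) = trig_sum m (\<lambda>j. if j = m then a else 0) x"
      by simp
  qed
  then show ?thesis unfolding trig_poly_def by blast
qed

lemma trig_poly_add:
  assumes "trig_poly f" "trig_poly g"
  shows "trig_poly (\<lambda>x. f x + g x)"
proof -
  obtain N c M d where fg: "f = trig_sum N c" "g = trig_sum M d" using assms by (auto simp: trig_poly_def)
  have "(\<lambda>x. f x + g x)
      = trig_sum (max N M) (\<lambda>j. (if j \<le> N then c j else 0) + (if j \<le> M then d j else 0))"
    unfolding fg trig_sum_add
    using trig_sum_change_degree[of "max N M" N c] trig_sum_change_degree[of "max N M" M d]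
    by (intro ext) (simp add: trig_sum_add)
  then show ?thesis unfolding trig_poly_def by blast
qed

lemma trig_poly_sum:
  assumes "\<And>i. i \<in> I \<Longrightarrow> trig_poly (f i)"
  shows "trig_poly (\<lambda>x. \<Sum>i\<in>I. f i x)"
  using assms
proof (induction I rule: infinite_finite_induct)
  case (insert i I)
  then show ?case using trig_poly_add[of "f i"] by simp
qed (use trig_poly_harmonic[of 0 0] in auto)

text \<open>
  The product of the real parts of \<open>z\<close> and \<open>w\<close> is half the real part of \<open>z * w + z * cnj w\<close>. Where
  the difference of the frequencies would be negative, \<open>z * cnj w\<close> is replaced by its conjugate.
\<close>

lemma trig_poly_harmonic_mult:
  "trig_poly (\<lambda>x. Re (a * cis (real j * x)) * Re (b * cis (real l * x)))"
proof -
  define m where "m = (if l \<le> j then j - l else l - j)"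
  define d where "d = (if l \<le> j then a * cnj b else cnj a * b)"
  have "Re (a * cis (real j * x)) * Re (b * cis (real l * x))
      = Re (a * b / 2 * cis (real (j + l) * x)) + Re (d / 2 * cis (real m * x))" for x
  proof -
    define z w where "z = a * cis (real j * x)" "w = b * cis (real l * x)"
    have half: "Re (u / 2 * v) = Re (u * v) / 2" for u v
      by (simp add: field_simps)
    have sum: "a * b * cis (real (j + l) * x) = z * w"
    proof -
      have "cis (real (j + l) * x) = cis (real j * x) * cis (real l * x)"
        by (simp add: cis_mult distrib_right)
      then show ?thesis by (simp only: z_w_def mult_ac)
    qed
    have difference: "Re (d * cis (real m * x)) = Re (z * cnj w)"
    proof (cases "l \<le> j")
      case True
      have "cis (real m * x) = cis (real j * x) * cnj (cis (real l * x))"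
        using True by (simp add: m_def cis_mult cis_cnj of_nat_diff algebra_simps)
      then have "d * cis (real m * x) = z * cnj w"
        using True by (simp only: d_def z_w_def if_True complex_cnj_mult mult_ac)
      then show ?thesis by simp
    next
      case False
      have "cis (real m * x) = cnj (cis (real j * x)) * cis (real l * x)"
        using False by (simp add: m_def cis_mult cis_cnj of_nat_diff algebra_simps)
      then have "d * cis (real m * x) = cnj (z * cnj w)"
        using False by (simp only: d_def z_w_def if_False complex_cnj_mult complex_cnj_cnj mult_ac)
      then show ?thesis by simp
    qed
    have "Re z * Re w = Re (z * w) / 2 + Re (z * cnj w) / 2" by (simp add: add_divide_distrib[symmetric])
    then show ?thesis unfolding half sum difference by (simp only: z_w_def)
  qed
  then show ?thesis
    by (simp only:) (rule trig_poly_add[OF trig_poly_harmonic trig_poly_harmonic])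
qed

lemma trig_poly_mult:
  assumes "trig_poly f" "trig_poly g"
  shows "trig_poly (\<lambda>x. f x * g x)"
proof -
  obtain N c M d where fg: "f = trig_sum N c" "g = trig_sum M d" using assms by (auto simp: trig_poly_def)
  show ?thesis
    unfolding fg trig_sum_def sum_product by (intro trig_poly_sum trig_poly_harmonic_mult)
qed

lemma trig_poly_real_polynomial_cis:
  assumes "real_polynomial_function P"
  shows "trig_poly (\<lambda>x. P (cis x))"
  using assms
proof (induction P rule: real_polynomial_function.induct)
  case (linear f)
  interpret f: bounded_linear f by fact
  have f: "f z = Re (Complex (f 1) (- f \<i>) * z)" for z
  proof -
    have "Re z *\<^sub>R 1 + Im z *\<^sub>R \<i> = z" by (simp add: complex_eq_iff)
    moreover have "f (Re z *\<^sub>R 1 + Im z *\<^sub>R \<i>) = Re z * f 1 + Im z * f \<i>"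
      by (simp only: f.add f.scaleR real_scaleR_def)
    ultimately have "f z = Re z * f 1 + Im z * f \<i>" by (simp only:)
    then show ?thesis by simp
  qed
  have "(\<lambda>x. f (cis x)) = (\<lambda>x. Re (Complex (f 1) (- f \<i>) * cis (real 1 * x)))"
    by (rule ext, subst f) simp
  then show ?case by (simp only: trig_poly_harmonic)
next
  case (const c)
  then show ?case using trig_poly_harmonic[of "complex_of_real c" 0] by simp
qed (auto intro: trig_poly_add trig_poly_mult)

lemma periodic_C_eq_of_cis_eq:
  assumes "f \<in> periodic_C" "cis a = cis b"
  shows "f a = f b"
proof -
  have per: "f (x + 2 * pi) = f x" for x using assms(1) by (simp add: periodic_C_def)
  have nat: "f (x + 2 * pi * real m) = f x" for x and m :: nat
  proof (induction m)
    case (Suc m)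
    then show ?case using per[of "x + 2 * pi * real m"] by (simp add: algebra_simps)
  qed simp
  have "sin a = sin b \<and> cos a = cos b" using assms(2) by (simp add: complex_eq_iff)
  then obtain m :: int where m: "a = b + 2 * pi * of_int m" unfolding sin_cos_eq_iff by blast
  show ?thesis
  proof (cases "m \<ge> 0")
    case True
    then show ?thesis using nat[of b "nat m"] m by simp
  next
    case False
    then show ?thesis using nat[of a "nat (- m)"] m by simp
  qed
qed

text \<open>
  A periodic function is a function on the unit circle, to which the Stone-Weierstrass theorem
  applies; a real polynomial in the coordinates of \<open>cis x\<close> is a trigonometric sum in \<open>x\<close>.
\<close>

lemma trig_sum_dense:
  assumes f: "f \<in> periodic_C" and "e > 0"
  obtains N c where "\<And>x. \<bar>f x - trig_sum N c x\<bar> < e"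
proof -
  define F where "F z = f (Arg z)" for z
  have cont_f: "isCont f x" for x
    using f by (simp add: periodic_C_def continuous_on_eq_continuous_at)
  have F_cis: "F (cis x) = f x" for x
    unfolding F_def by (rule periodic_C_eq_of_cis_eq[OF f]) (simp add: cis_Arg)
  \<comment> \<open>Continuity across the branch cut of \<open>Arg\<close> follows by switching to \<open>Arg2pi\<close>, which is cut elsewhere.\<close>
  have "continuous_on (sphere 0 1) F"
  proof (rule continuous_at_imp_continuous_on, rule ballI)
    fix z :: complex assume z: "z \<in> sphere 0 1"
    show "isCont F z"
    proof (cases "z \<in> \<real>\<^sub>\<le>\<^sub>0")
      case False
      then show ?thesis unfolding F_def
        by (intro isCont_o2[OF continuous_at_Arg cont_f])
    next
      case True
      with z have "z \<notin> \<real>\<^sub>\<ge>\<^sub>0" by (auto simp: complex_nonneg_Reals_iff complex_nonpos_Reals_iff complex_eq_iff cmod_def)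
      then have "isCont (\<lambda>z. f (Arg2pi z)) z" by (intro isCont_o2[OF continuous_at_Arg2pi cont_f])
      moreover have "F = (\<lambda>w. f (Arg2pi w))"
      proof
        fix w show "F w = f (Arg2pi w)"
        proof (cases "w = 0")
        case True
        then show ?thesis by (simp add: F_def Arg_zero)
      next
        case False
        have "w = of_real (norm w) * cis (Arg2pi w)" unfolding cis_conv_exp by (rule Arg2pi_eq)
        moreover have "of_real (norm w) * cis (Arg2pi w) / of_real (norm w) = cis (Arg2pi w)"
          using False by simp
        ultimately have "cis (Arg2pi w) = w / of_real (norm w)" by metis
        then have "cis (Arg w) = cis (Arg2pi w)" using cis_Arg[OF False] by (simp only: sgn_eq)
        then show ?thesis unfolding F_def by (rule periodic_C_eq_of_cis_eq[OF f])
        qed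
      qed
      ultimately show ?thesis by (simp only:)
    qed
  qed
  then obtain P where P: "real_polynomial_function P" "\<And>z. z \<in> sphere 0 1 \<Longrightarrow> \<bar>F z - P z\<bar> < e"
    using Stone_Weierstrass_real_polynomial_function[of "sphere 0 1" F e] assms(2) by auto
  obtain N c where c: "(\<lambda>x. P (cis x)) = trig_sum N c"
    using trig_poly_real_polynomial_cis[OF P(1)] unfolding trig_poly_def by blast
  then have "\<bar>f x - trig_sum N c x\<bar> < e" for x
    using P(2)[of "cis x"] fun_cong[OF c, of x] by (simp add: F_cis)
  then show ?thesis using that by blast
qed

section \<open>Uniform norms, moduli of smoothness and best approximation\<close>

lemma periodic_C_bounded:
  assumes "f \<in> periodic_C"
  obtains B where "\<And>x. \<bar>f x\<bar> \<le> B"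
proof -
  obtain N c where "\<And>x. \<bar>f x - trig_sum N c x\<bar> < 1" using trig_sum_dense[OF assms, of 1] by auto
  then have "\<bar>f x\<bar> \<le> 1 + (\<Sum>j\<le>N. cmod (c j))" for x
    using abs_trig_sum_le[of N c x] by (smt (verit))
  then show ?thesis using that by blast
qed

lemma trig_polys_bounded:
  assumes "\<tau> \<in> trig_polys m"
  obtains B where "\<And>x. \<bar>\<tau> x\<bar> \<le> B"
proof -
  obtain a0 a b where \<tau>: "\<And>x. \<tau> x = a0 + (\<Sum>k=1..m. a k * cos (real k * x) + b k * sin (real k * x))"
    using assms by (auto simp: trig_polys_def)
  have summand: "\<bar>a k * cos (real k * x) + b k * sin (real k * x)\<bar> \<le> \<bar>a k\<bar> + \<bar>b k\<bar>" for k x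
    by (intro order.trans[OF abs_triangle_ineq] add_mono) (auto simp: abs_mult intro: mult_left_le)
  have "\<bar>\<Sum>k=1..m. a k * cos (real k * x) + b k * sin (real k * x)\<bar>
      \<le> (\<Sum>k=1..m. \<bar>a k\<bar> + \<bar>b k\<bar>)" for x
    by (rule order.trans[OF sum_abs]) (intro sum_mono summand)
  then have "\<bar>\<tau> x\<bar> \<le> \<bar>a0\<bar> + (\<Sum>k=1..m. \<bar>a k\<bar> + \<bar>b k\<bar>)" for x
    unfolding \<tau> by (intro order.trans[OF abs_triangle_ineq] add_left_mono)
  then show ?thesis using that by blast
qed

lemma trig_sum_in_trig_polys: "trig_sum m c \<in> trig_polys m"
proof -
  have "trig_sum m c x = Re (c 0) + (\<Sum>k=1..m. Re (c k) * cos (real k * x) + (- Im (c k)) * sin (real k * x))" for x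
    unfolding trig_sum_def atMost_atLeast0 by (subst sum.atLeast_Suc_atMost) simp_all
  then show ?thesis unfolding trig_polys_def by (intro CollectI exI allI)
qed

lemma abs_le_sup_norm:
  assumes "\<And>x. \<bar>f x\<bar> \<le> B"
  shows "\<bar>f x\<bar> \<le> sup_norm f"
  unfolding sup_norm_def using assms by (intro cSUP_upper) (auto intro!: bdd_aboveI2)

lemma sup_norm_le:
  assumes "\<And>x. \<bar>f x\<bar> \<le> B"
  shows "sup_norm f \<le> B"
  unfolding sup_norm_def using assms by (intro cSUP_least) auto

lemma abs_fin_diff_le:
  assumes "\<And>x. \<bar>f x\<bar> \<le> B"
  shows "\<bar>fin_diff r h f x\<bar> \<le> 2 ^ r * B"
proof (induction r arbitrary: x)
  case 0
  then show ?case using assms by (simp add: fin_diff_def)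
next
  case (Suc r)
  show ?case using Suc[of x] Suc[of "x + h"] unfolding fin_diff_Suc by simp
qed

lemma abs_fin_diff_le_modulus:
  assumes "f \<in> periodic_C" "s \<in> {0<..\<delta>}"
  shows "\<bar>fin_diff r s f x\<bar> \<le> modulus_smoothness r f \<delta>"
proof -
  obtain B where B: "\<And>x. \<bar>f x\<bar> \<le> B" using periodic_C_bounded[OF assms(1)] by blast
  have "\<bar>fin_diff r s f x\<bar> \<le> sup_norm (fin_diff r s f)"
    by (rule abs_le_sup_norm[OF abs_fin_diff_le[OF B]])
  also have "\<dots> \<le> modulus_smoothness r f \<delta>"
    unfolding modulus_smoothness_def using assms(2)
    by (intro cSUP_upper) (auto intro!: bdd_aboveI2 sup_norm_le abs_fin_diff_le[OF B])
  finally show ?thesis .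
qed

lemma best_approx_le:
  assumes "f \<in> periodic_C" "\<tau> \<in> trig_polys m" "\<And>x. \<bar>f x - \<tau> x\<bar> \<le> B"
  shows "best_approx m f \<le> B"
proof -
  obtain A where A: "\<And>x. \<bar>f x\<bar> \<le> A" using periodic_C_bounded[OF assms(1)] by blast
  have "0 \<le> sup_norm (\<lambda>x. f x - \<sigma> x)" if \<sigma>: "\<sigma> \<in> trig_polys m" for \<sigma>
  proof -
    obtain D where D: "\<And>x. \<bar>\<sigma> x\<bar> \<le> D" using trig_polys_bounded[OF \<sigma>] by blast
    have "\<bar>f x - \<sigma> x\<bar> \<le> A + D" for x using A[of x] D[of x] by linarith
    from abs_le_sup_norm[of "\<lambda>x. f x - \<sigma> x", OF this, of 0] show ?thesis by linarith
  qed
  then have "best_approx m f \<le> sup_norm (\<lambda>x. f x - \<tau> x)"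
    unfolding best_approx_def using assms(2) by (intro cINF_lower bdd_belowI2[where m = 0])
  also have "\<dots> \<le> B" by (rule sup_norm_le[OF assms(3)])
  finally show ?thesis .
qed

section \<open>The inequality for continuous functions\<close>

text \<open>
  Every quantity in the inequality depends continuously on \<open>f\<close> in the uniform norm, so the case of
  trigonometric sums suffices.
\<close>

lemma jackson_stechkin_even:
  assumes f: "f \<in> periodic_C" and n: "n \<ge> 1" and k: "k \<ge> 1"
    and \<Omega>: "\<And>s x. s \<in> {0<..pi / real n} \<Longrightarrow> \<bar>fin_diff (2 * k) s f x\<bar> \<le> \<Omega>"
  shows "best_approx (n - 1) f \<le> 7430 * sqrt (real k) * gamma_star (2 * k) * \<Omega>"
proof -
  define K where "K = 7430 * sqrt (real k) * gamma_star (2 * k)"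
  have K: "K \<ge> 0" by (simp add: K_def gamma_star_def)
  have "\<bar>fin_diff (2 * k) (pi / real n) f 0\<bar> \<le> \<Omega>" using n by (intro \<Omega>) auto
  then have \<Omega>0: "\<Omega> \<ge> 0" by linarith
  have approx: "best_approx (n - 1) f \<le> K * \<Omega> + (1 + K * 2 ^ (2 * k)) * \<epsilon>" if \<epsilon>: "\<epsilon> > 0" for \<epsilon>
  proof -
    obtain N c where c: "\<And>x. \<bar>f x - trig_sum N c x\<bar> < \<epsilon>" using trig_sum_dense[OF f \<epsilon>] by blast
    have "\<bar>fin_diff (2 * k) s (trig_sum N c) x\<bar> \<le> \<Omega> + 2 ^ (2 * k) * \<epsilon>" if "s \<in> {0<..pi / real n}" for s x
    proof -
      have "fin_diff (2 * k) s (trig_sum N c) x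
          = fin_diff (2 * k) s f x - fin_diff (2 * k) s (\<lambda>x. f x - trig_sum N c x) x"
        by (simp add: fin_diff_def algebra_simps sum_subtractf)
      moreover have "\<bar>fin_diff (2 * k) s (\<lambda>x. f x - trig_sum N c x) x\<bar> \<le> 2 ^ (2 * k) * \<epsilon>"
        using c by (intro abs_fin_diff_le) (auto intro: less_imp_le)
      ultimately show ?thesis using \<Omega>[OF that, of x] by linarith
    qed
    then obtain b where b: "\<And>j. j \<ge> n \<Longrightarrow> b j = 0"
      "\<And>x. \<bar>trig_sum N c x - trig_sum N b x\<bar> \<le> K * (\<Omega> + 2 ^ (2 * k) * \<epsilon>)"
      using jackson_stechkin_trig_sum[OF n k, of "\<Omega> + 2 ^ (2 * k) * \<epsilon>" N c] \<Omega>0 \<epsilon>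
      unfolding K_def by auto
    have "trig_sum N b = trig_sum (n - 1) (\<lambda>j. if j \<le> N then b j else 0)"
      by (rule ext, rule trig_sum_change_degree) (use b(1) in auto)
    then have "trig_sum N b \<in> trig_polys (n - 1)" by (simp only: trig_sum_in_trig_polys)
    then show ?thesis
    proof (rule best_approx_le[OF f])
      fix x show "\<bar>f x - trig_sum N b x\<bar> \<le> K * \<Omega> + (1 + K * 2 ^ (2 * k)) * \<epsilon>"
        using c[of x] b(2)[of x] by (simp add: algebra_simps)
    qed
  qed
  have "best_approx (n - 1) f \<le> K * \<Omega>"
  proof (rule field_le_epsilon)
    fix e :: real assume "e > 0"
    have pos: "1 + K * 2 ^ (2 * k) > 0" using K by (simp add: add_pos_nonneg)
    then show "best_approx (n - 1) f \<le> K * \<Omega> + e"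
      using approx[of "e / (1 + K * 2 ^ (2 * k))"] \<open>e > 0\<close> by simp
  qed
  then show ?thesis by (simp add: K_def)
qed

lemma gamma_star_odd: "k \<ge> 1 \<Longrightarrow> gamma_star (2 * k - 1) = 2 * gamma_star (2 * k)"
proof -
  assume "k \<ge> 1"
  then obtain l where l: "k = Suc l" by (cases k) auto
  have "Suc (2 * l) choose Suc l = Suc (2 * l) choose l"
    using binomial_symmetric[of l "Suc (2 * l)"] by simp
  then have "2 * k choose k = 2 * ((2 * k - 1) choose (k - 1))" by (simp add: l)
  moreover have "(2 * k - 1) div 2 = k - 1" by (simp add: l)
  ultimately show ?thesis by (simp add: gamma_star_def)
qed

text \<open>
  The constants are \<open>c r = 7430 * sqrt r\<close>. For odd \<open>r = 2 * k - 1\<close> the difference of order \<open>2 * k\<close> is at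
  most twice that of order \<open>r\<close>, and the factor 2 is absorbed exactly by \<open>gamma_star\<close>.
\<close>

theorem theorem3:
  shows "\<exists>c :: nat \<Rightarrow> real.
    c \<in> O(\<lambda>r. sqrt (real r) * ln (real r)) \<and>
    (\<forall>r\<ge>1. \<forall>n\<ge>1. \<forall>f\<in>periodic_C.
       best_approx (n - 1) f \<le> c r * gamma_star r * modulus_smoothness r f (pi / real n))"
proof (intro exI[of _ "\<lambda>r. 7430 * sqrt (real r)"] conjI allI impI ballI)
  have "ln (real r) \<ge> 1" if "r \<ge> 3" for r
  proof -
    have "exp 1 \<le> real r" using exp_le that by linarith
    then show ?thesis using that by (subst ln_ge_iff) auto
  qed
  then have "eventually (\<lambda>r. norm (7430 * sqrt (real r)) \<le> 7430 * norm (sqrt (real r) * ln (real r))) at_top"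
    by (intro eventually_at_top_linorderI[of 3]) (simp add: abs_mult mult_le_cancel_left1)
  then show "(\<lambda>r. 7430 * sqrt (real r)) \<in> O(\<lambda>r. sqrt (real r) * ln (real r))" by (rule bigoI)
next
  fix r n :: nat and f assume r: "r \<ge> 1" and n: "n \<ge> 1" and f: "f \<in> periodic_C"
  define \<omega> where "\<omega> = modulus_smoothness r f (pi / real n)"
  have \<omega>: "\<bar>fin_diff r s f x\<bar> \<le> \<omega>" if "s \<in> {0<..pi / real n}" for s x
    unfolding \<omega>_def by (rule abs_fin_diff_le_modulus[OF f that])
  have "\<bar>fin_diff r (pi / real n) f 0\<bar> \<le> \<omega>" using n by (intro \<omega>) auto
  then have \<omega>0: "\<omega> \<ge> 0" by linarith
  define k where "k = (r + 1) div 2"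
  have k: "r = 2 * k \<or> r = 2 * k - 1" "1 \<le> k" "k \<le> r"
    unfolding k_def using r by presburger+
  have "best_approx (n - 1) f \<le> 7430 * sqrt (real k) * gamma_star r * \<omega>"
    using k(1)
  proof
    assume "r = 2 * k"
    then show ?thesis using jackson_stechkin_even[OF f n k(2), of \<omega>] \<omega> by simp
  next
    assume r_odd: "r = 2 * k - 1"
    then have suc: "2 * k = Suc r" using k(2) by simp
    have "\<bar>fin_diff (2 * k) s f x\<bar> \<le> 2 * \<omega>" if "s \<in> {0<..pi / real n}" for s x
      using \<omega>[OF that, of x] \<omega>[OF that, of "x + s"] unfolding suc fin_diff_Suc by linarith
    from jackson_stechkin_even[OF f n k(2) this] show ?thesis
      unfolding r_odd gamma_star_odd[OF k(2)] by simp
  qed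
  also have "\<dots> \<le> 7430 * sqrt (real r) * gamma_star r * \<omega>"
    using k(3) \<omega>0 by (intro mult_right_mono mult_left_mono) (auto simp: gamma_star_def)
  finally show "best_approx (n - 1) f \<le> 7430 * sqrt (real r) * gamma_star r * modulus_smoothness r f (pi / real n)"
    by (simp add: \<omega>_def)
qed

end
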